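(* Let $\delta,\varepsilon\in(0,1)$, let $T\ge1$ be an integer, and let $\mathfrak{B}_u:=\sup_{u\in\mathcal U}\|u\|$. Let the expert be the robust MPC controller $\boldsymbol\pi$ with disturbance set $\mathcal W=\mathbb B(\varepsilon)$. Assume that $\Pi$ is a finite class of maps containing the expert $\boldsymbol\pi$ with $\pi(x)\in\mathcal U$ for all $\pi\in\Pi$ and all $x$, and that the support of $\mathcal D$ is almost surely bounded. Choose integers $\ell,n$ with $$\ell\ge\frac{10\ln(T/\delta)}{\delta},\qquad n\ge\frac{14\,\ell\,\|B\|\,\mathfrak{B}_u\ln(2T\ell|\Pi|/\delta)}{\varepsilon\,\delta}.$$ Run Forward-Switch with parameters $n,T,\ell$, and let $\hat\tau_\infty$, $\hat\pi$ and $\tilde\pi_{0:T-1}$ be the resulting stopping time, learned controllers and output controller. For $x_0\sim\mathcal D$ (independent of the training data) let $\hat x_t=\varphi_t(x_0;\hat\pi_{0:t-1})$. Then there is an event $\bar{\mathcal E}$ of probability at least $1-3\delta$ over the randomness in the training process under which $\hat\tau_\infty\le\tau_\infty^\star$ and $$\text{(i)}\quad \mathbb P\big[\hat x_{\hat\tau_\infty}\in\bar{\mathcal O}_\infty\,\big|\,\hat\tau_\infty,\hat\pi\big]\ge1-\delta,$$ $$\text{(ii)}\quad \mathbb P\Big[\forall t\in\{0,\dots,\hat\tau_\infty-1\}:\ \|\boldsymbol\pi(\hat x_t)-\hat\pi_t(\hat x_t)\|\le\varepsilon/\|B\|\ \Big|\ \hat\tau_\infty,\hat\pi\Big]\ge1-\delta,$$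 where these probabilities are over the randomness in the initial state $x_0$. Further, under $\bar{\mathcal E}$ and whenever the two events inside the probabilities in (i) and (ii) hold for $x_0$, the controller $\tilde\pi_{0:T-1}$ started at $x_0$ does not violate any constraints (i.e. the states $\tilde x_t=\varphi_t(x_0;\tilde\pi_{0:t-1})$ and the inputs $\tilde\pi_t(\tilde x_t)$ stay in $\mathcal X$ and $\mathcal U$ respectively).
   Context: Dynamics: $x_{t+1}=Ax_t+Bu_t$ with constraints $x_t\in\mathcal X\subseteq\mathbb R^{d_x}$, $u_t\in\mathcal U\subseteq\mathbb R^{d_u}$, where $\mathcal X,\mathcal U$ are closed convex (polytopic) sets containing the origin. For controllers $\pi_{0:t-1}=(\pi_0,\dots,\pi_{t-1})$, $\varphi_t(x_0;\pi_{0:t-1})$ is the state at time $t$ started from $x_0$ with $u_s=\pi_s(x_s)$. $\|\cdot\|$ is the Euclidean/operator norm, $\mathbb B(r)$ the ball of radius $r$ centered at the origin, $\oplus$ (or $+$) the Minkowski sum, and $\mathcal X\ominus\mathcal Y=\{x\in\mathcal X: x+\mathcal Y\subseteq\mathcal X\}$. LQR: let $Q\succeq0$, $R\succ0$, let $P^{\rm lqr}$ be the unique positive definite solution of $P=A^\top PA-A^\top PB(R+B^\top PB)^{-1}B^\top PA+Q$, $K=-(R+B^\top P^{\rm lqr}B)^{-1}B^\top P^{\rm lqr}A$, $\pi^{\rm lqr}(x)=Kx$, $A_K=A+BK$, with spectral radius $\rho(A_K)<1$. Fix $\rho\in(\rho(A_K),1)$ and $\tau>0$ with $\|A_K^k\|\le\tau\rho^k$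 for all $k\ge0$ and put $\kappa=\tau/(1-\rho)$. Disturbance invariant set: $\mathcal W=\mathbb B(\varepsilon)$ and $\Delta_{\mathcal W}$ is a fixed disturbance invariant set, i.e. a neighborhood around the origin with $A_K\Delta_{\mathcal W}+\mathcal W\subseteq\Delta_{\mathcal W}$, with $\Delta_{\mathcal W}\subseteq\mathbb B(\kappa\varepsilon)$ (the minimal such set is $\sum_{k\ge0}A_K^k\mathcal W$). Tightened sets: $\bar{\mathcal X}=\mathcal X\ominus\Delta_{\mathcal W}$, $\bar{\mathcal U}=\mathcal U\ominus K\Delta_{\mathcal W}$. $\bar{\mathcal O}_\infty$ is the maximal set $\mathcal O\subseteq\bar{\mathcal X}$ such that whenever $x_0\in\mathcal O$, the sequence $x_{t+1}=A_Kx_t$ satisfies $x_t\in\mathcal O$ and $Kx_t\in\bar{\mathcal U}$ for all $t\ge0$. The terminal set is $\bar{\mathcal X}_{\rm f}=\bar{\mathcal O}_\infty$. MPC with tightened constraints: for a horizon $N$, a state $x$ and $\boldsymbol u=(u_0,\dots,u_{N-1})$, let $V_N(x,\boldsymbol u)=\sum_{k=0}^{N-1}(x_k^\top Qx_k+u_k^\top Ru_k)+x_N^\top P^{\rm lqr}x_N$ where $x_0=x$, $x_{k+1}=Ax_k+Bu_k$. The problem $\overline{\rm MPC}$ at $x$ is: minimize $V_N(x,\boldsymbol u)$ over $\boldsymbol u$ subject to $x_k\in\bar{\mathcal X}$, $u_k\in\bar{\mathcal U}$ for all $k$ and $x_N\in\bar{\mathcal X}_{\rm f}$. $\bar{\mathcal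 X}_0$ is the set of $x$ for which it is feasible. Robust MPC: for $x\in(\bar{\mathcal X}_0\oplus\Delta_{\mathcal W})\cap\mathcal X$, minimize $V_N(x_0,\boldsymbol u)$ over $(x_0,\boldsymbol u)$ subject to the constraints of $\overline{\rm MPC}$ at $x_0$ and $x\in x_0\oplus\Delta_{\mathcal W}$; let $\bar x_0(x),\bar u_0(x),\dots,\bar u_{N-1}(x)$ be the optimal solution. The robust MPC controller is $\boldsymbol\pi(x)=\bar u_0(x)+K(x-\bar x_0(x))$. Outside the domain on which it is defined, the expert is evaluated at the projection of the state onto its domain. Initial states: $\mathcal D$ is a probability distribution on initial states supported almost surely in $\bar{\mathcal X}_0$. $\tau_\infty^\star$: a time step (depending only on the system parameters) such that for every initial state $x_0$ in the support of $\mathcal D$ and every disturbance sequence $w_t\in\mathcal W$, the trajectory $x_{t+1}=Ax_t+B\boldsymbol\pi(x_t)+w_t$ satisfies $\bar x_0(x_{\tau_\infty^\star})\in\bar{\mathcal O}_\infty\ominus\Delta_{\mathcal W}$, and hence $x_{\tau_\infty^\star}\in\bar{\mathcal O}_\infty$. Forward Training Algorithm with parameters $n,T$ and expert $\pi^\star$: at stage $t=0,1,\dots,T-1$, given $\hat\pi_0,\dots,\hat\pi_{t-1}$, draw $m_t=\lceil n_t\rceil$ fresh i.i.d. initial states $x_0^{(i)}\sim\mathcal D$, where $n_t=c\,n\,t\lceil\ln^2(t+1)\rceil+n$, $c=\sum_{s\ge1}\frac1{s\ln^2(s+1)}$, set $\hat x_t^{(i)}=\varphi_t(x_0^{(i)};\hat\pi_{0:t-1})$,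 and choose $\hat\pi_t\in\arg\min_{\pi\in\Pi}\frac1{m_t}\sum_{i=1}^{m_t}\|\pi^\star(\hat x_t^{(i)})-\pi(\hat x_t^{(i)})\|$. Forward-Switch with parameters $n,T,\ell$: initialize $\hat\tau_\infty=T$ and run the Forward Training Algorithm with expert $\pi^\star=\boldsymbol\pi$. At the end of each stage $t-1$ ($t\ge1$), sample $\ell$ fresh independent initial states from $\mathcal D$ and generate the corresponding states $\hat x_t^{(i)}$, $i=1,\dots,\ell$, at time $t$ under $\hat\pi_{0:t-1}$. If $\hat x_t^{(i)}\in\bar{\mathcal O}_\infty$ for all $i=1,\dots,\ell$, terminate the training and set $\hat\tau_\infty=t$; otherwise proceed to the next stage. Output $\tilde\pi_{0:T-1}$ with $\tilde\pi_t=\hat\pi_t$ for $t<\hat\tau_\infty$ and $\tilde\pi_t=\pi^{\rm lqr}$ for $\hat\tau_\infty\le t\le T-1$. "Randomness in the training process" is that of all initial states sampled by the algorithm.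
   Formalization: Formalized with τ∞* ≥ 1 (tests start at t=1, so the stopping time is never 0), and (i) is asserted only if τ∞* ≤ T or the stopping time is < T; otherwise it can equal T by initialization with no test passed, and (i) fails. *)

theory Defs
  imports "HOL-Probability.Probability" "HOL-Library.Set_Algebras"
begin

definition pos_semidef :: "real^'k^'k \<Rightarrow> bool" where
  "pos_semidef M \<longleftrightarrow> transpose M = M \<and> (\<forall>x. 0 \<le> x \<bullet> (M *v x))"

definition pos_def :: "real^'k^'k \<Rightarrow> bool" where
  "pos_def M \<longleftrightarrow> transpose M = M \<and> (\<forall>x. x \<noteq> 0 \<longrightarrow> 0 < x \<bullet> (M *v x))"

abbreviation op_norm :: "real^'k^'j \<Rightarrow> real" where
  "op_norm M \<equiv> onorm ((*v) M)"

text \<open>The eigenvalues are the complex ones, so the real matrix is first complexified.\<close>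

definition spectral_radius :: "real^'k^'k \<Rightarrow> real" where
  "spectral_radius M =
     Max (cmod ` {z. \<exists>v::complex^'k. v \<noteq> 0 \<and> (\<chi> i j. complex_of_real (M $ i $ j)) *v v = z *s v})"

text \<open>Minkowski sums are the library's \<open>S + T\<close> on sets.\<close>

definition minkowski_diff :: "'v::plus set \<Rightarrow> 'v set \<Rightarrow> 'v set"  (infixl "\<ominus>" 65) where
  "S \<ominus> Y = {x \<in> S. \<forall>y\<in>Y. x + y \<in> S}"

definition measure_support :: "'v::topological_space measure \<Rightarrow> 'v set" where
  "measure_support D = {x. \<forall>S. open S \<longrightarrow> x \<in> S \<longrightarrow> 0 < emeasure D S}"

definition riccati_solution ::
  "real^'n^'n \<Rightarrow> real^'m^'n \<Rightarrow> real^'n^'n \<Rightarrow> real^'m^'m \<Rightarrow> real^'n^'n \<Rightarrow> bool" where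
  "riccati_solution A B Q R P \<longleftrightarrow>
     P = transpose A ** P ** A
         - transpose A ** P ** B ** matrix_inv (R + transpose B ** P ** B) ** transpose B ** P ** A
         + Q"

definition lqr_gain ::
  "real^'n^'n \<Rightarrow> real^'m^'n \<Rightarrow> real^'m^'m \<Rightarrow> real^'n^'n \<Rightarrow> real^'n^'m" where
  "lqr_gain A B R P = - (matrix_inv (R + transpose B ** P ** B) ** transpose B ** P ** A)"

primrec input_traj ::
  "real^'n^'n \<Rightarrow> real^'m^'n \<Rightarrow> (nat \<Rightarrow> real^'m) \<Rightarrow> real^'n \<Rightarrow> nat \<Rightarrow> real^'n" where
  "input_traj A B u x 0 = x"
| "input_traj A B u x (Suc k) = A *v input_traj A B u x k + B *v u k"

text \<open>\<open>traj A B p x0 t\<close> is the state \<open>\<phi>\<^sub>t(x0; p\<^sub>0, \<dots>, p\<^sub>t\<^sub>-\<^sub>1)\<close>; values \<open>p s\<close> with \<open>s \<ge> t\<close> are irrelevant.\<close>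

primrec traj ::
  "real^'n^'n \<Rightarrow> real^'m^'n \<Rightarrow> (nat \<Rightarrow> real^'n \<Rightarrow> real^'m) \<Rightarrow> real^'n \<Rightarrow> nat \<Rightarrow> real^'n" where
  "traj A B p x0 0 = x0"
| "traj A B p x0 (Suc t) = A *v traj A B p x0 t + B *v p t (traj A B p x0 t)"

primrec disturbed_traj ::
  "real^'n^'n \<Rightarrow> real^'m^'n \<Rightarrow> (real^'n \<Rightarrow> real^'m) \<Rightarrow> (nat \<Rightarrow> real^'n) \<Rightarrow> real^'n \<Rightarrow> nat \<Rightarrow> real^'n" where
  "disturbed_traj A B p w x0 0 = x0"
| "disturbed_traj A B p w x0 (Suc t) =
     A *v disturbed_traj A B p w x0 t + B *v p (disturbed_traj A B p w x0 t) + w t"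

definition disturbance_invariant ::
  "real^'n^'n \<Rightarrow> (real^'n) set \<Rightarrow> (real^'n) set \<Rightarrow> bool" where
  "disturbance_invariant AK W \<Delta> \<longleftrightarrow> 0 \<in> interior \<Delta> \<and> (*v) AK ` \<Delta> + W \<subseteq> \<Delta>"

text \<open>The defining property is closed under unions, so the maximal set is the union of all
  sets having it.\<close>

definition max_admissible ::
  "real^'n^'n \<Rightarrow> real^'n^'m \<Rightarrow> (real^'n) set \<Rightarrow> (real^'m) set \<Rightarrow> (real^'n) set" where
  "max_admissible AK K X U =
     \<Union>{S. S \<subseteq> X \<and> (\<forall>x\<in>S. \<forall>t. ((*v) AK ^^ t) x \<in> S \<and> K *v ((*v) AK ^^ t) x \<in> U)}"

definition mpc_cost ::
  "real^'n^'n \<Rightarrow> real^'m^'n \<Rightarrow> real^'n^'n \<Rightarrow> real^'m^'m \<Rightarrow> real^'n^'n \<Rightarrow> nat \<Rightarrow>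
   real^'n \<Rightarrow> (nat \<Rightarrow> real^'m) \<Rightarrow> real" where
  "mpc_cost A B Q R P N x u =
     (\<Sum>k<N. input_traj A B u x k \<bullet> (Q *v input_traj A B u x k) + u k \<bullet> (R *v u k))
     + input_traj A B u x N \<bullet> (P *v input_traj A B u x N)"

definition mpc_feasible ::
  "real^'n^'n \<Rightarrow> real^'m^'n \<Rightarrow> (real^'n) set \<Rightarrow> (real^'m) set \<Rightarrow> (real^'n) set \<Rightarrow> nat \<Rightarrow>
   real^'n \<Rightarrow> (nat \<Rightarrow> real^'m) \<Rightarrow> bool" where
  "mpc_feasible A B X U Xf N x u \<longleftrightarrow>
     (\<forall>k\<le>N. input_traj A B u x k \<in> X) \<and> (\<forall>k<N. u k \<in> U) \<and> input_traj A B u x N \<in> Xf"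

definition mpc_domain ::
  "real^'n^'n \<Rightarrow> real^'m^'n \<Rightarrow> (real^'n) set \<Rightarrow> (real^'m) set \<Rightarrow> (real^'n) set \<Rightarrow> nat \<Rightarrow>
   (real^'n) set" where
  "mpc_domain A B X U Xf N = {x. \<exists>u. mpc_feasible A B X U Xf N x u}"

text \<open>Here \<open>X\<close>, \<open>U\<close>, \<open>Xf\<close> are the tightened sets, and the pair \<open>(z, u)\<close> is an optimal solution of
  the robust problem at the state \<open>x\<close>.\<close>

definition robust_mpc_optimal ::
  "real^'n^'n \<Rightarrow> real^'m^'n \<Rightarrow> real^'n^'n \<Rightarrow> real^'m^'m \<Rightarrow> real^'n^'n \<Rightarrow>
   (real^'n) set \<Rightarrow> (real^'m) set \<Rightarrow> (real^'n) set \<Rightarrow> nat \<Rightarrow> (real^'n) set \<Rightarrow>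
   real^'n \<Rightarrow> real^'n \<Rightarrow> (nat \<Rightarrow> real^'m) \<Rightarrow> bool" where
  "robust_mpc_optimal A B Q R P X U Xf N \<Delta> x z u \<longleftrightarrow>
     is_arg_min (\<lambda>(z, u). mpc_cost A B Q R P N z u)
       (\<lambda>(z, u). mpc_feasible A B X U Xf N z u \<and> x \<in> {z} + \<Delta>) (z, u)"

text \<open>\<open>Dom\<close> is the domain of the controller; \<open>xbar\<close> and \<open>ubar\<close> select an optimal solution.\<close>

definition robust_mpc_controller ::
  "real^'n^'m \<Rightarrow> (real^'n) set \<Rightarrow> (real^'n \<Rightarrow> real^'n) \<Rightarrow> (real^'n \<Rightarrow> nat \<Rightarrow> real^'m) \<Rightarrow>
   real^'n \<Rightarrow> real^'m" where
  "robust_mpc_controller K Dom xbar ubar x =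
     (let y = (if x \<in> Dom then x else closest_point Dom x)
      in ubar y 0 + K *v (y - xbar y))"

text \<open>\<open>Train t i\<close> is the \<open>i\<close>-th initial state drawn for the regression of stage \<open>t\<close>, and \<open>Test t i\<close>
  the \<open>i\<close>-th one drawn at the end of stage \<open>t - 1\<close> for the test at time \<open>t\<close>; \<open>i\<close> counts from \<open>0\<close>.
  The training randomness is a family of independent draws from \<open>D\<close>, of which a run of the
  algorithm reads only finitely many.\<close>

datatype sample = Train nat nat | Test nat nat

fun stage :: "sample \<Rightarrow> nat" where
  "stage (Train t i) = t"
| "stage (Test t i) = t"

definition training_space :: "'v measure \<Rightarrow> (sample \<Rightarrow> 'v) measure" where
  "training_space D = PiM UNIV (\<lambda>_. D)"

text \<open>Choosing among several empirical minimizers is left to the learner; the choice of stage \<open>t\<close>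
  has to be a measurable function of the data seen so far.\<close>

definition data_driven ::
  "'v measure \<Rightarrow> ('v \<Rightarrow> 'c) set \<Rightarrow> nat \<Rightarrow> ((sample \<Rightarrow> 'v) \<Rightarrow> nat \<Rightarrow> 'v \<Rightarrow> 'c) \<Rightarrow> bool" where
  "data_driven D Pol T phat \<longleftrightarrow>
     (\<forall>t<T. \<exists>g \<in> PiM {s. stage s \<le> t} (\<lambda>_. D) \<rightarrow>\<^sub>M count_space Pol.
        \<forall>\<omega> \<in> space (training_space D). phat \<omega> t = g (restrict \<omega> {s. stage s \<le> t}))"

definition sched_const :: real where
  "sched_const = (\<Sum>s. 1 / (real (Suc s) * (ln (real (Suc s) + 1))\<^sup>2))"

definition num_samples :: "nat \<Rightarrow> nat \<Rightarrow> nat" where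
  "num_samples n t =
     nat \<lceil>sched_const * real n * real t * real_of_int \<lceil>(ln (real t + 1))\<^sup>2\<rceil> + real n\<rceil>"

definition empirical_loss ::
  "nat \<Rightarrow> ('v \<Rightarrow> 'c::real_normed_vector) \<Rightarrow> (nat \<Rightarrow> 'v) \<Rightarrow> ('v \<Rightarrow> 'c) \<Rightarrow> real" where
  "empirical_loss m expert xs p = 1 / real m * (\<Sum>i<m. norm (expert (xs i) - p (xs i)))"

definition test_passed ::
  "real^'n^'n \<Rightarrow> real^'m^'n \<Rightarrow> (real^'n) set \<Rightarrow> nat \<Rightarrow> (sample \<Rightarrow> real^'n) \<Rightarrow>
   (nat \<Rightarrow> real^'n \<Rightarrow> real^'m) \<Rightarrow> nat \<Rightarrow> bool" where
  "test_passed A B Oinf l \<omega> p t \<longleftrightarrow> (\<forall>i<l. traj A B p (\<omega> (Test t i)) t \<in> Oinf)"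

text \<open>\<open>(p, \<tau>)\<close> are the learned controllers and the stopping time of a run on the data \<open>\<omega>\<close>: the first
  time in \<open>1..T\<close> at which the test is passed, and \<open>T\<close> if there is none. Training ends at \<open>\<tau>\<close>, so
  \<open>p t\<close> is an empirical minimizer only for \<open>t < \<tau>\<close>; later values are never used.\<close>

definition forward_switch_run ::
  "real^'n^'n \<Rightarrow> real^'m^'n \<Rightarrow> (real^'n) set \<Rightarrow> (real^'n \<Rightarrow> real^'m) \<Rightarrow> (real^'n \<Rightarrow> real^'m) set \<Rightarrow>
   nat \<Rightarrow> nat \<Rightarrow> nat \<Rightarrow> (sample \<Rightarrow> real^'n) \<Rightarrow> (nat \<Rightarrow> real^'n \<Rightarrow> real^'m) \<Rightarrow> nat \<Rightarrow> bool" where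
  "forward_switch_run A B Oinf expert Pol n T l \<omega> p \<tau> \<longleftrightarrow>
     \<tau> = Min (insert T {t \<in> {1..T}. test_passed A B Oinf l \<omega> p t}) \<and>
     (\<forall>t<\<tau>. is_arg_min
        (empirical_loss (num_samples n t) expert (\<lambda>i. traj A B p (\<omega> (Train t i)) t))
        (\<lambda>q. q \<in> Pol) (p t))"

definition switched_controller ::
  "real^'n^'m \<Rightarrow> nat \<Rightarrow> (nat \<Rightarrow> real^'n \<Rightarrow> real^'m) \<Rightarrow> nat \<Rightarrow> real^'n \<Rightarrow> real^'m" where
  "switched_controller K \<tau> p t = (if t < \<tau> then p t else (*v) K)"

end

theory Submission
  imports Defs
begin

text \<open>Two mechanisms combine: a statistical one, which makes the learned policies agree with the
  expert along their own trajectories, and a control one, which makes small disagreements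
  harmless.

  Learning. The expert belongs to the policy class, so an empirical minimizer has zero empirical
  loss and agrees with the expert at all its \<open>m\<^sub>t\<close> training states. A fixed policy whose error
  exceeds \<open>\<epsilon> / \<parallel>B\<parallel>\<close> with probability more than \<open>L / m\<^sub>t\<close> survives \<open>m\<^sub>t\<close> fresh states with
  probability at most \<open>exp (- L)\<close>; with \<open>L = ln (|Pol| T / \<delta>)\<close> a union bound over stages and
  policies shows that, up to probability \<open>\<delta>\<close>, each policy learned before stopping errs with
  probability at most \<open>L / m\<^sub>t\<close> (\<open>zero_empirical_error_generalizes\<close>). The schedule is such that
  these bounds sum to at most \<open>2 L / n \<le> \<delta> / l\<close> (\<open>stagewise_error_budget\<close>). The factor
  \<open>\<parallel>B\<parallel> Bu / \<epsilon>\<close> in the bound on \<open>n\<close> does no harm: when it is at most \<open>1 / 2\<close>, any two policies with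
  values in \<open>U\<close> already agree up to the tolerance. The states seen at stage \<open>t\<close> depend on the
  policies learned earlier, hence are not independent of the past; but only finitely many tuples
  of earlier policies exist, and given such a tuple the fresh initial states are independent of
  the past (\<open>fresh_samples_adaptive\<close>).

  Control. An input error of \<open>\<epsilon> / \<parallel>B\<parallel>\<close> acts as a state disturbance in \<open>W\<close>
  (\<open>traj_eq_disturbed_traj\<close>), which robust MPC tolerates: its domain is invariant under such
  disturbances (\<open>Dom_invariant\<close>), and by the choice of \<open>\<tau>star\<close> the state lies in \<open>Oinf\<close> at time
  \<open>\<tau>star\<close>.

  Stopping. If training has not stopped before \<open>\<tau>star\<close>, the learned trajectory misses \<open>Oinf\<close> at
  \<open>\<tau>star\<close> with probability at most \<open>\<delta> / l\<close>, so that all \<open>l\<close> tests at \<open>\<tau>star\<close> succeed up to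
  probability \<open>\<delta>\<close> (\<open>rare_event_avoids_tests\<close>) and training stops there. Conversely, if \<open>Oinf\<close> is
  missed at time \<open>t\<close> with probability more than \<open>\<delta>\<close>, then all \<open>l\<close> tests at \<open>t\<close> succeed with
  probability at most \<open>(1 - \<delta>)^l \<le> \<delta> / T\<close>, so up to probability \<open>\<delta>\<close> no passed test misleads
  (\<open>passed_tests_are_reliable\<close>). The three exceptional events account for \<open>3 \<delta>\<close>.\<close>

section \<open>Sample sizes\<close>

text \<open>Bertrand's series. The difference \<open>1 / ln a - 1 / ln (a + 1)\<close> is at least of order
  \<open>1 / (a (ln (a + 1))\<^sup>2)\<close>, which gives a telescoping majorant.\<close>

lemma sched_const_summable:
  "summable (\<lambda>s. 1 / (real (Suc s) * (ln (real (Suc s) + 1))\<^sup>2))"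
proof -
  let ?g = "\<lambda>s. 1 / ln (real s + 2)"
  have "?g \<longlonglongrightarrow> 0" by real_asymp
  then have tel: "summable (\<lambda>s. 2 * (?g s - ?g (Suc s)))"
    by (intro summable_mult telescope_summable')
  have bound: "norm (1 / (real (Suc (Suc s)) * (ln (real (Suc (Suc s)) + 1))\<^sup>2))
      \<le> 2 * (?g s - ?g (Suc s))" for s
  proof -
    define a where "a = real s + 2"
    have a: "a \<ge> 2" by (simp add: a_def)
    define u where "u = ln a"
    define v where "v = ln (a + 1)"
    have u: "u > 0" and uv: "u \<le> v" using a by (simp_all add: u_def v_def)
    \<comment> \<open>\<open>1 / (a + 1) \<le> ln (a + 1) - ln a\<close>, which makes the terms telescope up to a factor 2\<close>
    have "ln (a / (a + 1)) \<le> a / (a + 1) - 1" using a by (intro ln_le_minus_one) auto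
    then have "1 / (a + 1) \<le> v - u"
      using a by (simp add: u_def v_def ln_div field_simps)
    moreover have "1 / a \<le> 2 / (a + 1)" using a by (simp add: field_simps)
    ultimately have *: "1 / a \<le> 2 * (v - u)" by simp
    have "1 / (a * v\<^sup>2) = (1 / a) / v\<^sup>2" by simp
    also have "\<dots> \<le> 2 * (v - u) / v\<^sup>2" using * by (intro divide_right_mono) auto
    also have "\<dots> \<le> 2 * (v - u) / (u * v)"
      using u uv by (intro divide_left_mono) (auto simp: power2_eq_square)
    also have "\<dots> = 2 * (1 / u - 1 / v)" using u uv by (simp add: field_simps)
    finally have "1 / (a * v\<^sup>2) \<le> 2 * (1 / u - 1 / v)" .
    then show ?thesis using a by (simp add: a_def u_def v_def add_ac)
  qed
  \<comment> \<open>the bound starts at the second term, since \<open>1 / ln 1\<close> is not available\<close>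
  have "summable (\<lambda>s. 1 / (real (Suc (Suc s)) * (ln (real (Suc (Suc s)) + 1))\<^sup>2))"
    by (rule summable_comparison_test'[OF tel, of 0]) (rule bound)
  then show ?thesis by (subst summable_Suc_iff[symmetric])
qed

lemma sched_const_pos: "sched_const > 0"
  unfolding sched_const_def
  by (rule suminf_pos[OF sched_const_summable]) simp

lemma num_samples_ge: "real (num_samples n t) \<ge> real n"
proof -
  have "sched_const * real n * real t * real_of_int \<lceil>(ln (real t + 1))\<^sup>2\<rceil> \<ge> 0"
    using sched_const_pos by (intro mult_nonneg_nonneg) (auto simp: less_le_trans[of "-1" 0])
  then show ?thesis unfolding num_samples_def by linarith
qed

lemma num_samples_Suc_ge:
  "real (num_samples n (Suc s)) \<ge>
     real n * sched_const * (real (Suc s) * (ln (real (Suc s) + 1))\<^sup>2)"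
proof -
  have "real n * sched_const * (real (Suc s) * (ln (real (Suc s) + 1))\<^sup>2)
      \<le> real n * sched_const * (real (Suc s) * real_of_int \<lceil>(ln (real (Suc s) + 1))\<^sup>2\<rceil>)"
    using sched_const_pos by (intro mult_left_mono) (auto simp: le_of_int_ceiling)
  also have "\<dots> \<le> real (num_samples n (Suc s))"
    unfolding num_samples_def by (simp add: mult_ac) linarith
  finally show ?thesis .
qed

text \<open>Stage \<open>0\<close> contributes at most \<open>1 / n\<close>, and \<open>sched_const\<close> normalizes the later stages to contribute
  at most \<open>1 / n\<close> in total, however many there are.\<close>

lemma sum_inverse_num_samples_le:
  assumes "n > 0"
  shows "(\<Sum>t<T. 1 / real (num_samples n t)) \<le> 2 / real n"
proof -
  let ?b = "\<lambda>s. 1 / (real (Suc s) * (ln (real (Suc s) + 1))\<^sup>2)"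
  have "(\<Sum>t<T. 1 / real (num_samples n t)) \<le> (\<Sum>t<Suc T. 1 / real (num_samples n t))"
    by (simp add: sum.lessThan_Suc)
  also have "\<dots> = 1 / real (num_samples n 0) + (\<Sum>s<T. 1 / real (num_samples n (Suc s)))"
    by (rule sum.lessThan_Suc_shift)
  also have "\<dots> \<le> 1 / real n + (\<Sum>s<T. 1 / (real n * sched_const) * ?b s)"
  proof (intro add_mono sum_mono)
    show "1 / real (num_samples n 0) \<le> 1 / real n"
      using num_samples_ge[of n 0] assms by (intro divide_left_mono) auto
    show "1 / real (num_samples n (Suc s)) \<le> 1 / (real n * sched_const) * ?b s" for s
    proof -
      have pos: "real n * sched_const * (real (Suc s) * (ln (real (Suc s) + 1))\<^sup>2) > 0"
        using assms sched_const_pos by simp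
      have "1 / real (num_samples n (Suc s))
          \<le> 1 / (real n * sched_const * (real (Suc s) * (ln (real (Suc s) + 1))\<^sup>2))"
        using num_samples_Suc_ge[of n s] pos
          by (intro divide_left_mono) (auto simp del: of_nat_Suc intro: mult_pos_pos less_le_trans)
      then show ?thesis by (simp add: mult_ac)
    qed
  qed
  also have "\<dots> = 1 / real n + 1 / (real n * sched_const) * (\<Sum>s<T. ?b s)"
    by (simp only: sum_distrib_left)
  also have "\<dots> \<le> 1 / real n + 1 / (real n * sched_const) * sched_const"
    unfolding sched_const_def[symmetric]
    using sum_le_suminf[OF sched_const_summable, of "{..<T}"] sched_const_pos
    by (intro add_left_mono mult_left_mono) (auto simp: sched_const_def)
  also have "\<dots> = 2 / real n" using sched_const_pos by simp
  finally show ?thesis .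
qed

text \<open>Here \<open>c\<close> is the size of the policy class and \<open>r\<close> stands for \<open>\<parallel>B\<parallel> Bu\<close>. The sum on the left
  adds up the error probabilities certified at each stage. Its bound \<open>\<delta> / l\<close> leaves room for a union bound
  over \<open>l\<close> tests.\<close>

lemma stagewise_error_budget:
  assumes \<delta>: "0 < \<delta>" "\<delta> < 1" and T: "1 \<le> T" and l: "0 < l" and c: "1 \<le> c" and r: "\<epsilon> < 2 * r" "0 < \<epsilon>"
    and n: "real n \<ge> 14 * real l * r * ln (2 * real T * real l * real c / \<delta>) / (\<epsilon> * \<delta>)"
  shows "0 < n" and "(\<Sum>t<T. ln (real c * real T / \<delta>) / real (num_samples n t)) \<le> \<delta> / real l"
proof -
  define L where "L = ln (real c * real T / \<delta>)"
  define L' where "L' = ln (2 * real T * real l * real c / \<delta>)"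
  have cT: "1 \<le> real c * real T" using c T by (metis of_nat_mult of_nat_1 of_nat_le_iff mult_le_mono mult_1)
  then have L: "0 < L" unfolding L_def using \<delta> by (intro ln_gt_zero) (simp add: field_simps)
  have "real c * real T \<le> 2 * real T * real l * real c"
    using l cT by (cases l) (auto simp: field_simps)
  then have "L \<le> L'" unfolding L_def L'_def using cT \<delta>
    by (intro ln_mono divide_right_mono divide_pos_pos) (linarith | simp)+
  with L have L': "0 < L'" by simp
  \<comment> \<open>The factor \<open>r / \<epsilon>\<close> in the sample size exceeds \<open>1 / 2\<close>.\<close>
  have "7 * real l * L' / \<delta> \<le> 2 * r / \<epsilon> * (7 * real l * L' / \<delta>)"
    using r \<delta> L' l mult_right_mono[of 1 "2 * r / \<epsilon>" "7 * real l * L' / \<delta>"] by simp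
  also have "\<dots> \<le> real n" using n by (simp add: L'_def field_simps)
  finally have n': "7 * real l * L' / \<delta> \<le> real n" .
  moreover have "7 * real l * L' / \<delta> > 0" using l L' \<delta> by simp
  ultimately show n0: "0 < n" by (cases n) auto
  have "(\<Sum>t<T. L / real (num_samples n t)) = L * (\<Sum>t<T. 1 / real (num_samples n t))"
    by (simp add: sum_distrib_left)
  also have "\<dots> \<le> L * (2 / real n)"
    using L sum_inverse_num_samples_le[OF n0] by (intro mult_left_mono) auto
  also have "\<dots> \<le> \<delta> / real l"
  proof -
    have "2 * (real l * L) \<le> 7 * (real l * L')" using \<open>L \<le> L'\<close> L l by (intro mult_mono) auto
    also have "\<dots> \<le> \<delta> * real n" using n' \<delta> by (simp add: field_simps)
    finally show ?thesis using l n0 by (simp add: field_simps)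
  qed
  finally show "(\<Sum>t<T. ln (real c * real T / \<delta>) / real (num_samples n t)) \<le> \<delta> / real l"
    by (simp add: L_def)
qed

lemma num_tests_sufficient:
  assumes \<delta>: "0 < \<delta>" "\<delta> < 1" and T: "1 \<le> T" and l: "real l \<ge> 10 * ln (real T / \<delta>) / \<delta>"
  shows "0 < l" and "real T * (1 - \<delta>) ^ l \<le> \<delta>"
proof -
  have L: "ln (real T / \<delta>) > 0" using assms by (intro ln_gt_zero) (auto simp: field_simps)
  then have "10 * ln (real T / \<delta>) / \<delta> > 0" using \<delta> by simp
  then show "0 < l" using l by (cases l) auto
  have "ln (real T / \<delta>) \<le> 10 * ln (real T / \<delta>)" using L by simp
  also have "\<dots> \<le> \<delta> * real l" using l \<delta> by (simp add: field_simps)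
  finally have *: "ln (real T / \<delta>) \<le> \<delta> * real l" .
  have "(1 - \<delta>) ^ l \<le> exp (- \<delta>) ^ l"
    using \<delta> exp_ge_add_one_self[of "- \<delta>"] by (intro power_mono) auto
  also have "\<dots> = exp (- (\<delta> * real l))" by (simp add: exp_of_nat_mult[symmetric] mult.commute)
  also have "\<dots> \<le> exp (- ln (real T / \<delta>))" using * by simp
  also have "\<dots> = \<delta> / real T" using \<delta> T by (simp add: exp_minus)
  finally show "real T * (1 - \<delta>) ^ l \<le> \<delta>" using T by (simp add: field_simps)
qed

section \<open>Fresh samples and policies learned from earlier data\<close>

lemma prob_space_training_space:
  assumes "prob_space D" shows "prob_space (training_space D)"
  unfolding training_space_def using assms by (rule prob_space_PiM)

lemma indep_vars_coordinates:
  assumes "prob_space D"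
  shows "prob_space.indep_vars (training_space D) (\<lambda>_. D) (\<lambda>s \<omega>. \<omega> s) (UNIV :: sample set)"
proof -
  interpret D: prob_space D by fact
  interpret product_prob_space "\<lambda>_. D" "UNIV :: sample set" ..
  have "distr (training_space D) (\<Pi>\<^sub>M s\<in>(UNIV :: sample set). D) (\<lambda>\<omega>. \<lambda>s\<in>UNIV. \<omega> s)
      = training_space D"
    by (simp add: training_space_def restrict_UNIV distr_id2)
  moreover have "distr (training_space D) D (\<lambda>\<omega>. \<omega> s) = D" for s
    using PiM_component[of s] by (simp add: training_space_def)
  ultimately show ?thesis
    unfolding training_space_def
    by (subst indep_vars_iff_distr_eq_PiM) (auto simp: training_space_def)
qed

lemma measure_fresh_samples:
  assumes D: "prob_space D" and I: "finite I" and V: "V \<in> sets D"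
  shows "{\<omega> \<in> space (training_space D). \<forall>i\<in>I. \<omega> i \<in> V} \<in> sets (training_space D)"
    and "measure (training_space D) {\<omega> \<in> space (training_space D). \<forall>i\<in>I. \<omega> i \<in> V}
           = measure D V ^ card I"
proof -
  interpret D: prob_space D by fact
  interpret product_prob_space "\<lambda>_. D" "UNIV :: sample set" ..
  have eq: "{\<omega> \<in> space (PiM UNIV (\<lambda>_. D)). \<forall>i\<in>I. \<omega> i \<in> V}
      = prod_emb UNIV (\<lambda>_. D) I (Pi\<^sub>E I (\<lambda>_. V))"
    using sets.sets_into_space[OF V] by (auto simp: prod_emb_def space_PiM)
  show "{\<omega> \<in> space (training_space D). \<forall>i\<in>I. \<omega> i \<in> V} \<in> sets (training_space D)"
    unfolding training_space_def eq using I V by (intro sets_PiM_I) auto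
  show "measure (training_space D) {\<omega> \<in> space (training_space D). \<forall>i\<in>I. \<omega> i \<in> V}
           = measure D V ^ card I"
    unfolding training_space_def eq using I V by (subst measure_PiM_emb) auto
qed

lemma indep_past_fresh_samples:
  assumes D: "prob_space D" and I: "I \<subseteq> {s. stage s = t}" "finite I" and V: "V \<in> sets D"
    and H: "H \<in> sets (PiM {s. stage s < t} (\<lambda>_. D))"
  defines "M \<equiv> training_space D"
  defines "past \<equiv> {\<omega> \<in> space M. restrict \<omega> {s. stage s < t} \<in> H}"
  defines "fresh \<equiv> {\<omega> \<in> space M. \<forall>i\<in>I. \<omega> i \<in> V}"
  shows "past \<in> sets M" and "measure M (past \<inter> fresh) = measure M past * measure D V ^ card I"
proof -
  interpret M: prob_space M unfolding M_def using D by (rule prob_space_training_space)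
  let ?J = "{s. stage s < t}"
  let ?F = "{f \<in> space (PiM I (\<lambda>_. D)). \<forall>i\<in>I. f i \<in> V}"
  have F: "?F \<in> sets (PiM I (\<lambda>_. D))"
  proof -
    have "?F = Pi\<^sub>E I (\<lambda>_. V)" using sets.sets_into_space[OF V] by (auto simp: space_PiM)
    then show ?thesis using I V by (simp add: sets_PiM_I_finite)
  qed
  have ind: "M.indep_var (PiM ?J (\<lambda>_. D)) (\<lambda>\<omega>. restrict (\<lambda>s. \<omega> s) ?J)
      (PiM I (\<lambda>_. D)) (\<lambda>\<omega>. restrict (\<lambda>s. \<omega> s) I)"
    unfolding M_def using I D
    by (intro prob_space.indep_var_restrict[OF prob_space_training_space indep_vars_coordinates]) auto
  have rv: "(\<lambda>\<omega>. restrict \<omega> ?J) \<in> M \<rightarrow>\<^sub>M PiM ?J (\<lambda>_. D)"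
    using M.indep_var_rv1[OF ind] by simp
  have past: "past = (\<lambda>\<omega>. restrict \<omega> ?J) -` H \<inter> space M"
    by (auto simp: past_def)
  show "past \<in> sets M" unfolding past using rv H by (rule measurable_sets)
  have fresh: "fresh = (\<lambda>\<omega>. restrict \<omega> I) -` ?F \<inter> space M"
    by (auto simp: fresh_def M_def training_space_def space_PiM PiE_iff)
  have "measure M (past \<inter> fresh) = M.prob ((\<lambda>\<omega>. (restrict \<omega> ?J, restrict \<omega> I)) -` (H \<times> ?F) \<inter> space M)"
    unfolding past fresh by (intro arg_cong[where f = "measure M"]) auto
  also have "\<dots> = measure M past * measure M fresh"
    unfolding past fresh using M.indep_varD[OF ind H F] by simp
  also have "measure M fresh = measure D V ^ card I"
    unfolding fresh_def M_def using D I V by (intro measure_fresh_samples)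
  finally show "measure M (past \<inter> fresh) = measure M past * measure D V ^ card I" .
qed

lemma data_driven_mem:
  assumes "data_driven D Pol T phat" "t < T" "\<omega> \<in> space (training_space D)"
  shows "phat \<omega> t \<in> Pol"
proof -
  obtain g where "g \<in> PiM {s. stage s \<le> t} (\<lambda>_. D) \<rightarrow>\<^sub>M count_space Pol"
    "phat \<omega> t = g (restrict \<omega> {s. stage s \<le> t})"
    using assms unfolding data_driven_def by blast
  moreover have "restrict \<omega> {s. stage s \<le> t} \<in> space (PiM {s. stage s \<le> t} (\<lambda>_. D))"
    using assms(3) by (auto simp: training_space_def space_PiM)
  ultimately show ?thesis by (auto dest: measurable_space)
qed

text \<open>A tuple of learned policies is an event of the past: every policy learned before stage \<open>t\<close>
  reads only data of stages before \<open>t\<close>.\<close>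

lemma data_driven_past:
  assumes "data_driven D Pol T phat" "t \<le> T" "\<And>s. s < t \<Longrightarrow> p s \<in> Pol"
  shows "\<exists>H \<in> sets (PiM {s. stage s < t} (\<lambda>_. D)). \<forall>\<omega> \<in> space (training_space D).
    restrict \<omega> {s. stage s < t} \<in> H \<longleftrightarrow> (\<forall>s<t. phat \<omega> s = p s)"
proof -
  let ?J = "{s. stage s < t}" and ?L = "\<lambda>s. {r. stage r \<le> s}"
  have "\<forall>s. \<exists>g. s < T \<longrightarrow> g \<in> PiM (?L s) (\<lambda>_. D) \<rightarrow>\<^sub>M count_space Pol \<and>
      (\<forall>\<omega> \<in> space (training_space D). phat \<omega> s = g (restrict \<omega> (?L s)))"
    using assms(1) unfolding data_driven_def by blast
  then obtain g where g: "\<And>s. s < T \<Longrightarrow> g s \<in> PiM (?L s) (\<lambda>_. D) \<rightarrow>\<^sub>M count_space Pol"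
      "\<And>s \<omega>. s < T \<Longrightarrow> \<omega> \<in> space (training_space D) \<Longrightarrow> phat \<omega> s = g s (restrict \<omega> (?L s))"
    by metis
  define H where "H = {f \<in> space (PiM ?J (\<lambda>_. D)). \<forall>s\<in>{..<t}. g s (restrict f (?L s)) = p s}"
  have single: "{f \<in> space (PiM ?J (\<lambda>_. D)). g s (restrict f (?L s)) = p s}
      \<in> sets (PiM ?J (\<lambda>_. D))" if "s < t" for s
  proof -
    have "(\<lambda>f. g s (restrict f (?L s))) \<in> PiM ?J (\<lambda>_. D) \<rightarrow>\<^sub>M count_space Pol"
      using that assms(2)
      by (intro measurable_compose[OF measurable_restrict_subset g(1)]) auto
    from measurable_sets[OF this, of "{p s}"] assms(3)[OF that] show ?thesis
      by (simp add: vimage_def Int_def conj_commute)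
  qed
  have "H \<in> sets (PiM ?J (\<lambda>_. D))"
    unfolding H_def by (intro sets.sets_Collect_finite_All single) auto
  moreover have "restrict \<omega> ?J \<in> H \<longleftrightarrow> (\<forall>s<t. phat \<omega> s = p s)"
    if \<omega>: "\<omega> \<in> space (training_space D)" for \<omega>
  proof -
    have "restrict \<omega> ?J \<in> space (PiM ?J (\<lambda>_. D))"
      using \<omega> by (auto simp: training_space_def space_PiM)
    moreover have "g s (restrict (restrict \<omega> ?J) (?L s)) = phat \<omega> s" if "s < t" for s
    proof -
      have "?J \<inter> ?L s = ?L s" using that by auto
      then show ?thesis using g(2)[OF _ \<omega>, of s] that assms(2) by simp
    qed
    ultimately show ?thesis by (auto simp: H_def)
  qed
  ultimately show ?thesis by blast
qed

text \<open>A bound for fixed policies transfers to learned ones: split the event according to the tuple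
  of earlier policies. On each of the finitely many pieces the set \<open>V\<close> is fixed and the fresh
  samples are independent of the piece, and the probabilities of the pieces sum to one.\<close>

lemma fresh_samples_adaptive:
  assumes D: "prob_space D" and dd: "data_driven D Pol T phat" and Pol: "finite Pol"
    and t: "t \<le> T" and I: "I \<subseteq> {s. stage s = t}" "finite I"
    and V: "\<And>p. (\<And>s. s < t \<Longrightarrow> p s \<in> Pol) \<Longrightarrow> V p \<in> sets D"
    and prefix: "\<And>p q. (\<And>s. s < t \<Longrightarrow> p s = q s) \<Longrightarrow> V p = V q"
    and b: "\<And>p. (\<And>s. s < t \<Longrightarrow> p s \<in> Pol) \<Longrightarrow> measure D (V p) ^ card I \<le> b"
  defines "M \<equiv> training_space D"
  shows "{\<omega> \<in> space M. \<forall>i\<in>I. \<omega> i \<in> V (phat \<omega>)} \<in> sets M"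
    and "measure M {\<omega> \<in> space M. \<forall>i\<in>I. \<omega> i \<in> V (phat \<omega>)} \<le> b"
proof -
  interpret M: prob_space M unfolding M_def using D by (rule prob_space_training_space)
  \<comment> \<open>\<open>Q\<close>: the possible values of the policies learned before stage \<open>t\<close>\<close>
  define Q where "Q = PiE {..<t} (\<lambda>_. Pol)"
  have Q: "finite Q" unfolding Q_def using Pol by (intro finite_PiE) auto
  define past where "past p = {\<omega> \<in> space M. \<forall>s<t. phat \<omega> s = p s}" for p
  define fresh where "fresh p = {\<omega> \<in> space M. \<forall>i\<in>I. \<omega> i \<in> V p}" for p
  have past: "past p \<in> sets M"
    and indep: "measure M (past p \<inter> fresh p) = measure M (past p) * measure D (V p) ^ card I"
    and fresh: "fresh p \<in> sets M" if "p \<in> Q" for p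
  proof -
    have p: "\<And>s. s < t \<Longrightarrow> p s \<in> Pol" using that by (auto simp: Q_def)
    obtain H where H: "H \<in> sets (PiM {s. stage s < t} (\<lambda>_. D))"
      "\<And>\<omega>. \<omega> \<in> space (training_space D) \<Longrightarrow>
         restrict \<omega> {s. stage s < t} \<in> H \<longleftrightarrow> (\<forall>s<t. phat \<omega> s = p s)"
      using data_driven_past[OF dd t, of p, OF p] by blast
    have eq: "past p = {\<omega> \<in> space M. restrict \<omega> {s. stage s < t} \<in> H}"
      unfolding past_def M_def using H(2) by blast
    have Vp: "V p \<in> sets D" by (rule V) (rule p)
    note * = indep_past_fresh_samples[OF D I Vp H(1), folded M_def]
    show "past p \<in> sets M" unfolding eq by (rule *)
    show "measure M (past p \<inter> fresh p) = measure M (past p) * measure D (V p) ^ card I"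
      unfolding eq fresh_def by (rule *)
    show "fresh p \<in> sets M"
      unfolding fresh_def M_def using D I(2) Vp by (rule measure_fresh_samples)
  qed
  have cover: "\<exists>p\<in>Q. \<omega> \<in> past p" if "\<omega> \<in> space M" for \<omega>
  proof
    show "restrict (phat \<omega>) {..<t} \<in> Q"
      using data_driven_mem[OF dd] that t by (auto simp: Q_def M_def)
    show "\<omega> \<in> past (restrict (phat \<omega>) {..<t})" using that by (auto simp: past_def)
  qed
  have V_past: "V (phat \<omega>) = V p" if "\<omega> \<in> past p" for \<omega> p
    using that by (intro prefix) (simp add: past_def)
  have eq: "{\<omega> \<in> space M. \<forall>i\<in>I. \<omega> i \<in> V (phat \<omega>)} = (\<Union>p\<in>Q. past p \<inter> fresh p)"
  proof (intro set_eqI iffI)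
    fix \<omega> assume \<omega>: "\<omega> \<in> {\<omega> \<in> space M. \<forall>i\<in>I. \<omega> i \<in> V (phat \<omega>)}"
    then obtain p where "p \<in> Q" "\<omega> \<in> past p" using cover by blast
    with \<omega> V_past[of \<omega> p] show "\<omega> \<in> (\<Union>p\<in>Q. past p \<inter> fresh p)" by (auto simp: fresh_def)
  next
    fix \<omega> assume "\<omega> \<in> (\<Union>p\<in>Q. past p \<inter> fresh p)"
    then show "\<omega> \<in> {\<omega> \<in> space M. \<forall>i\<in>I. \<omega> i \<in> V (phat \<omega>)}"
      using V_past by (auto simp: fresh_def)
  qed
  show "{\<omega> \<in> space M. \<forall>i\<in>I. \<omega> i \<in> V (phat \<omega>)} \<in> sets M"
    unfolding eq using Q past fresh by auto
  have disj: "disjoint_family_on past Q"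
    unfolding disjoint_family_on_def
  proof (intro ballI impI equals0I)
    fix p q \<omega> assume pq: "p \<in> Q" "q \<in> Q" "p \<noteq> q" "\<omega> \<in> past p \<inter> past q"
    then have "p = q"
      unfolding Q_def by (intro PiE_ext[of p _ _ q]) (auto simp: past_def)
    with pq show False by simp
  qed
  have b0: "b \<ge> 0"
  proof -
    obtain \<omega> where "\<omega> \<in> space M" using M.not_empty by blast
    then have "measure D (V (phat \<omega>)) ^ card I \<le> b"
      using data_driven_mem[OF dd] t by (intro b) (auto simp: M_def)
    then show ?thesis by (smt (verit) zero_le_power measure_nonneg)
  qed
  have "measure M (\<Union>p\<in>Q. past p \<inter> fresh p) \<le> (\<Sum>p\<in>Q. measure M (past p \<inter> fresh p))"
    using Q past fresh by (intro M.finite_measure_subadditive_finite) auto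
  also have "\<dots> \<le> (\<Sum>p\<in>Q. measure M (past p) * b)"
    using indep b by (intro sum_mono) (auto simp: Q_def intro!: mult_left_mono)
  also have "\<dots> = measure M (\<Union>p\<in>Q. past p) * b"
    using Q past disj by (subst M.finite_measure_finite_Union) (auto simp: sum_distrib_right)
  also have "\<dots> \<le> 1 * b" using b0 by (intro mult_right_mono) auto
  finally show "measure M {\<omega> \<in> space M. \<forall>i\<in>I. \<omega> i \<in> V (phat \<omega>)} \<le> b" by (simp add: eq)
qed

lemma union_bound_complement:
  assumes M: "prob_space M" and I: "finite I" and B: "\<And>i. i \<in> I \<Longrightarrow> B i \<in> sets M"
    and b: "\<And>i. i \<in> I \<Longrightarrow> measure M (B i) \<le> b" and \<delta>: "real (card I) * b \<le> \<delta>"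
  shows "space M - (\<Union>i\<in>I. B i) \<in> sets M" and "measure M (space M - (\<Union>i\<in>I. B i)) \<ge> 1 - \<delta>"
proof -
  interpret prob_space M by fact
  have meas: "(\<Union>i\<in>I. B i) \<in> sets M" using I B by auto
  then show "space M - (\<Union>i\<in>I. B i) \<in> sets M" by auto
  have "prob (\<Union>i\<in>I. B i) \<le> (\<Sum>i\<in>I. prob (B i))"
    using I B by (intro finite_measure_subadditive_finite) auto
  also have "\<dots> \<le> real (card I) * b" using b by (intro sum_bounded_above)
  finally show "prob (space M - (\<Union>i\<in>I. B i)) \<ge> 1 - \<delta>"
    using \<delta> prob_compl[OF meas] by simp
qed

section \<open>What training errors and tests certify\<close>

text \<open>\<open>Err t p q\<close> is the set of initial states for which policy \<open>q\<close> errs at time \<open>t\<close> after the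
  policies \<open>p\<close> have been applied. A policy with error probability above \<open>L / m\<close> passes \<open>m\<close> fresh
  samples without error with probability at most \<open>(1 - L / m)^m \<le> exp (- L)\<close>. The value of \<open>L\<close>
  balances the union bound over all stages and policies.\<close>

lemma zero_empirical_error_generalizes:
  fixes Err :: "nat \<Rightarrow> (nat \<Rightarrow> 'v \<Rightarrow> 'c) \<Rightarrow> ('v \<Rightarrow> 'c) \<Rightarrow> 'v set"
  assumes D: "prob_space D" and dd: "data_driven D Pol T phat"
    and Pol: "finite Pol" "Pol \<noteq> {}" and T: "1 \<le> T" and \<delta>: "0 < \<delta>" and m: "\<And>t. 0 < m t"
    and Err: "\<And>t p q. (\<And>s. s < t \<Longrightarrow> p s \<in> Pol) \<Longrightarrow> q \<in> Pol \<Longrightarrow> Err t p q \<in> sets D"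
    and prefix: "\<And>t p p' q. (\<And>s. s < t \<Longrightarrow> p s = p' s) \<Longrightarrow> Err t p q = Err t p' q"
  shows "\<exists>E \<in> sets (training_space D). measure (training_space D) E \<ge> 1 - \<delta> \<and>
    (\<forall>\<omega>\<in>E. \<forall>t<T. (\<forall>i<m t. \<omega> (Train t i) \<notin> Err t (phat \<omega>) (phat \<omega> t)) \<longrightarrow>
       measure D (Err t (phat \<omega>) (phat \<omega> t)) \<le> ln (real (card Pol) * real T / \<delta>) / real (m t))"
proof -
  interpret D: prob_space D by fact
  let ?M = "training_space D"
  define L where "L = ln (real (card Pol) * real T / \<delta>)"
  \<comment> \<open>\<open>V\<close> is empty if \<open>q\<close> errs rarely enough, so that only bad policies lead to \<open>Bad\<close>.\<close>
  define V where "V t q p = (if measure D (Err t p q) > L / real (m t) then space D - Err t p q else {})"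
    for t q p
  define Bad where "Bad = (\<lambda>(t, q). {\<omega> \<in> space ?M. \<forall>s\<in>Train t ` {..<m t}. \<omega> s \<in> V t q (phat \<omega>)})"
  have cardpos: "real (card Pol) * real T > 0" using Pol T by (auto simp: card_gt_0_iff)
  have b: "measure D (V t q p) ^ card (Train t ` {..<m t}) \<le> exp (- L)"
    if p: "\<And>s. s < t \<Longrightarrow> p s \<in> Pol" and q: "q \<in> Pol" for t q p
  proof -
    have "measure D (V t q p) \<le> exp (- (L / real (m t)))"
      using D.prob_compl[OF Err[OF p q]] exp_ge_add_one_self[of "- (L / real (m t))"]
      by (auto simp: V_def)
    then have "measure D (V t q p) ^ m t \<le> exp (- (L / real (m t))) ^ m t"
      by (intro power_mono) auto
    also have "\<dots> = exp (- L)"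
      using m[of t] by (simp add: exp_of_nat_mult[symmetric])
    finally show ?thesis by (simp add: card_image inj_on_def)
  qed
  have Bad: "Bad i \<in> sets ?M" "measure ?M (Bad i) \<le> exp (- L)" if mem: "i \<in> {..<T} \<times> Pol" for i
  proof -
    obtain t q where i: "i = (t, q)" "t < T" "q \<in> Pol" using mem by (cases i) auto
    have V: "V t q p \<in> sets D" if "\<And>s. s < t \<Longrightarrow> p s \<in> Pol" for p
      using Err[OF that i(3)] by (auto simp: V_def)
    have V': "V t q p = V t q p'" if "\<And>s. s < t \<Longrightarrow> p s = p' s" for p p'
      using prefix[of t p p' q] that by (simp add: V_def)
    note * = fresh_samples_adaptive[OF D dd Pol(1), of t "Train t ` {..<m t}" "V t q" "exp (- L)",
        OF less_imp_le[OF i(2)] _ _ V V' b[OF _ i(3)]]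
    show "Bad i \<in> sets ?M" unfolding Bad_def i prod.case by (rule *(1)) auto
    show "measure ?M (Bad i) \<le> exp (- L)" unfolding Bad_def i prod.case by (rule *(2)) auto
  qed
  have "real (card ({..<T} \<times> Pol)) * exp (- L) \<le> \<delta>"
    using cardpos \<delta> by (simp add: L_def exp_minus card_cartesian_product mult.commute)
  note E = union_bound_complement[where B = Bad and I = "{..<T} \<times> Pol",
      OF prob_space_training_space[OF D] _ Bad this]
  have "measure D (Err t (phat \<omega>) (phat \<omega> t)) \<le> L / real (m t)"
    if \<omega>: "\<omega> \<in> space ?M - (\<Union>i\<in>{..<T} \<times> Pol. Bad i)" and t: "t < T"
      and none: "\<forall>i<m t. \<omega> (Train t i) \<notin> Err t (phat \<omega>) (phat \<omega> t)" for \<omega> t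
  proof (rule ccontr)
    assume "\<not> measure D (Err t (phat \<omega>) (phat \<omega> t)) \<le> L / real (m t)"
    then have "V t (phat \<omega> t) (phat \<omega>) = space D - Err t (phat \<omega>) (phat \<omega> t)"
      by (simp add: V_def)
    moreover have "\<omega> s \<in> space D" for s
      using \<omega> by (auto simp: training_space_def space_PiM)
    ultimately have "\<omega> \<in> Bad (t, phat \<omega> t)" using \<omega> none by (auto simp: Bad_def)
    moreover have "phat \<omega> t \<in> Pol" using data_driven_mem[OF dd t] \<omega> by blast
    ultimately show False using \<omega> t by blast
  qed
  then show ?thesis using E Pol(1) unfolding L_def by blast
qed

text \<open>If \<open>V\<close> has probability below \<open>1 - \<delta>\<close>, then \<open>l\<close> fresh samples all lie in it with probability
  at most \<open>(1 - \<delta>)^l\<close>; a union bound over the \<open>T\<close> test times follows.\<close>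

lemma passed_tests_are_reliable:
  fixes V :: "nat \<Rightarrow> (nat \<Rightarrow> 'v \<Rightarrow> 'c) \<Rightarrow> 'v set"
  assumes D: "prob_space D" and dd: "data_driven D Pol T phat" and Pol: "finite Pol"
    and \<delta>: "0 < \<delta>" "\<delta> < 1" and l: "real T * (1 - \<delta>) ^ l \<le> \<delta>"
    and V: "\<And>t p. (\<And>s. s < t \<Longrightarrow> p s \<in> Pol) \<Longrightarrow> V t p \<in> sets D"
    and prefix: "\<And>t p p'. (\<And>s. s < t \<Longrightarrow> p s = p' s) \<Longrightarrow> V t p = V t p'"
  shows "\<exists>E \<in> sets (training_space D). measure (training_space D) E \<ge> 1 - \<delta> \<and>
    (\<forall>\<omega>\<in>E. \<forall>t\<in>{1..T}. (\<forall>i<l. \<omega> (Test t i) \<in> V t (phat \<omega>)) \<longrightarrow>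
       measure D (V t (phat \<omega>)) \<ge> 1 - \<delta>)"
proof -
  let ?M = "training_space D"
  define V' where "V' t p = (if measure D (V t p) < 1 - \<delta> then V t p else {})" for t p
  define Bad where "Bad t = {\<omega> \<in> space ?M. \<forall>s\<in>Test t ` {..<l}. \<omega> s \<in> V' t (phat \<omega>)}" for t
  have Bad: "Bad t \<in> sets ?M" "measure ?M (Bad t) \<le> (1 - \<delta>) ^ l" if "t \<in> {1..T}" for t
  proof -
    have V'1: "V' t p \<in> sets D" if "\<And>s. s < t \<Longrightarrow> p s \<in> Pol" for p
      using V[OF that] by (auto simp: V'_def)
    have V'2: "V' t p = V' t p'" if "\<And>s. s < t \<Longrightarrow> p s = p' s" for p p'
      using prefix[of t p p'] that by (simp add: V'_def)
    have b: "measure D (V' t p) ^ card (Test t ` {..<l}) \<le> (1 - \<delta>) ^ l" for p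
      using \<delta> by (auto simp: V'_def card_image inj_on_def intro!: power_mono)
    note * = fresh_samples_adaptive[OF D dd Pol, of t "Test t ` {..<l}" "V' t" "(1 - \<delta>) ^ l",
        OF _ _ _ V'1 V'2 b]
    show "Bad t \<in> sets ?M" unfolding Bad_def by (rule *(1)) (use that in auto)
    show "measure ?M (Bad t) \<le> (1 - \<delta>) ^ l"
      unfolding Bad_def by (rule *(2)) (use that in auto)
  qed
  have "real (card {1..T}) * (1 - \<delta>) ^ l \<le> \<delta>" using l by simp
  note E = union_bound_complement[where B = Bad and I = "{1..T}",
      OF prob_space_training_space[OF D] _ Bad this]
  have "measure D (V t (phat \<omega>)) \<ge> 1 - \<delta>"
    if "\<omega> \<in> space ?M - (\<Union>t\<in>{1..T}. Bad t)" "t \<in> {1..T}" "\<forall>i<l. \<omega> (Test t i) \<in> V t (phat \<omega>)"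
    for \<omega> t
  proof (rule ccontr)
    assume "\<not> measure D (V t (phat \<omega>)) \<ge> 1 - \<delta>"
    then have "\<omega> \<in> Bad t" using that by (auto simp: Bad_def V'_def)
    then show False using that by blast
  qed
  then show ?thesis using E by blast
qed

text \<open>This is what makes training stop in time: when \<open>V\<close> is the event of missing the target set,
  the tests are passed. It is a union bound over the \<open>l\<close> test samples.\<close>

lemma rare_event_avoids_tests:
  fixes V :: "(nat \<Rightarrow> 'v \<Rightarrow> 'c) \<Rightarrow> 'v set"
  assumes D: "prob_space D" and dd: "data_driven D Pol T phat" and Pol: "finite Pol"
    and t: "t \<le> T" and \<delta>: "0 \<le> \<delta>" and l: "0 < l"
    and V: "\<And>p. (\<And>s. s < t \<Longrightarrow> p s \<in> Pol) \<Longrightarrow> V p \<in> sets D"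
    and prefix: "\<And>p p'. (\<And>s. s < t \<Longrightarrow> p s = p' s) \<Longrightarrow> V p = V p'"
  shows "\<exists>E \<in> sets (training_space D). measure (training_space D) E \<ge> 1 - \<delta> \<and>
    (\<forall>\<omega>\<in>E. measure D (V (phat \<omega>)) \<le> \<delta> / real l \<longrightarrow> (\<forall>i<l. \<omega> (Test t i) \<notin> V (phat \<omega>)))"
proof -
  let ?M = "training_space D"
  define V' where "V' p = (if measure D (V p) \<le> \<delta> / real l then V p else {})" for p
  define Bad where "Bad i = {\<omega> \<in> space ?M. \<forall>s\<in>{Test t i}. \<omega> s \<in> V' (phat \<omega>)}" for i
  have Bad: "Bad i \<in> sets ?M" "measure ?M (Bad i) \<le> \<delta> / real l" if "i \<in> {..<l}" for i
  proof -
    have V'1: "V' p \<in> sets D" if "\<And>s. s < t \<Longrightarrow> p s \<in> Pol" for p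
      using V[OF that] by (auto simp: V'_def)
    have V'2: "V' p = V' p'" if "\<And>s. s < t \<Longrightarrow> p s = p' s" for p p'
      using prefix[of p p'] that by (simp add: V'_def)
    have b: "measure D (V' p) ^ card {Test t i} \<le> \<delta> / real l" for p
      using \<delta> by (auto simp: V'_def)
    note * = fresh_samples_adaptive[OF D dd Pol, of t "{Test t i}" "V'" "\<delta> / real l",
        OF t _ _ V'1 V'2 b]
    show "Bad i \<in> sets ?M" unfolding Bad_def by (rule *(1)) auto
    show "measure ?M (Bad i) \<le> \<delta> / real l" unfolding Bad_def by (rule *(2)) auto
  qed
  have "real (card {..<l}) * (\<delta> / real l) \<le> \<delta>" using l by simp
  note E = union_bound_complement[where B = Bad and I = "{..<l}",
      OF prob_space_training_space[OF D] _ Bad this]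
  have "\<omega> (Test t i) \<notin> V (phat \<omega>)"
    if "\<omega> \<in> space ?M - (\<Union>i\<in>{..<l}. Bad i)" "measure D (V (phat \<omega>)) \<le> \<delta> / real l" "i < l" for \<omega> i
  proof
    assume "\<omega> (Test t i) \<in> V (phat \<omega>)"
    then have "\<omega> \<in> Bad i" using that by (auto simp: Bad_def V'_def)
    then show False using that by blast
  qed
  then show ?thesis using E by blast
qed

text \<open>The expert has zero loss, hence so does every minimizer.\<close>

lemma realizable_empirical_minimizer:
  assumes "is_arg_min (empirical_loss m expert xs) (\<lambda>q. q \<in> Pol) p" "expert \<in> Pol" "i < m"
  shows "p (xs i) = expert (xs i)"
proof -
  have "empirical_loss m expert xs expert = 0" by (simp add: empirical_loss_def)
  then have "empirical_loss m expert xs p \<le> 0"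
    using assms by (auto simp: is_arg_min_def not_less dest!: spec[of _ expert])
  then have "(\<Sum>i<m. norm (expert (xs i) - p (xs i))) \<le> 0"
    using assms(3) by (simp add: empirical_loss_def divide_le_0_iff)
  then have "(\<Sum>i<m. norm (expert (xs i) - p (xs i))) = 0"
    by (simp add: order_antisym sum_nonneg)
  then show ?thesis using assms(3) by (simp add: sum_nonneg_eq_0_iff)
qed

lemma forward_switch_run_stop:
  assumes "forward_switch_run A B Oinf expert Pol n T l \<omega> p \<tau>" "1 \<le> T"
  shows "1 \<le> \<tau>" "\<tau> \<le> T"
    and "\<tau> = T \<or> test_passed A B Oinf l \<omega> p \<tau>"
    and "1 \<le> t \<Longrightarrow> t \<le> T \<Longrightarrow> test_passed A B Oinf l \<omega> p t \<Longrightarrow> \<tau> \<le> t"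
proof -
  let ?S = "insert T {t \<in> {1..T}. test_passed A B Oinf l \<omega> p t}"
  have \<tau>: "\<tau> = Min ?S" using assms unfolding forward_switch_run_def by blast
  have fin: "finite ?S" by simp
  have mem: "\<tau> \<in> ?S" unfolding \<tau> by (intro Min_in) auto
  then show "1 \<le> \<tau>" "\<tau> \<le> T" "\<tau> = T \<or> test_passed A B Oinf l \<omega> p \<tau>" using assms(2) by auto
  show "\<tau> \<le> t" if "1 \<le> t" "t \<le> T" "test_passed A B Oinf l \<omega> p t"
    unfolding \<tau> using that fin by (intro Min_le) auto
qed

section \<open>Trajectories and the support of the initial distribution\<close>

lemma norm_matrix_vector_le: "norm (M *v x) \<le> op_norm M * norm x"
  for M :: "real^'j^'k"
  by (rule onorm[OF matrix_vector_mul_bounded_linear])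

lemma op_norm_pos: "M \<noteq> 0 \<Longrightarrow> 0 < op_norm M" for M :: "real^'j^'k"
  by (metis onorm_pos_lt matrix_vector_mul_bounded_linear matrix_eq matrix_vector_mult_0)

lemma traj_cong:
  assumes "\<And>s. s < t \<Longrightarrow> p s = q s"
  shows "traj A B p x t = traj A B q x t"
  using assms by (induction t) auto

lemma traj_measurable:
  assumes "\<And>s. s < t \<Longrightarrow> p s \<in> borel_measurable borel"
  shows "(\<lambda>x. traj A B p x t) \<in> borel_measurable borel"
  using assms
proof (induction t)
  case (Suc t)
  have lin: "(\<lambda>x. M *v x) \<in> borel_measurable borel" for M :: "real^'j^'k"
    by (intro borel_measurable_continuous_onI matrix_vector_mult_linear_continuous_on)
  have IH: "(\<lambda>x. traj A B p x t) \<in> borel_measurable borel" using Suc by simp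
  have pt: "(\<lambda>x. p t (traj A B p x t)) \<in> borel_measurable borel"
    using IH Suc.prems by (intro measurable_compose[OF IH]) auto
  show ?case
    by (simp, intro borel_measurable_add measurable_compose[OF IH lin] measurable_compose[OF pt lin])
qed simp

text \<open>By the Lindelof property the complement of the support, a union of open null sets, is a
  countable such union.\<close>

lemma AE_measure_support:
  fixes D :: "'v::second_countable_topology measure"
  assumes "sets D = sets borel"
  shows "AE x in D. x \<in> measure_support D"
proof -
  let ?F = "{S. open S \<and> emeasure D S = 0}"
  obtain F where F: "F \<subseteq> ?F" "countable F" "\<Union>F = \<Union>?F"
    using Lindelof[of ?F] by auto
  have "(\<Union>S\<in>F. S) \<in> null_sets D"
    using F by (intro null_sets_UN') (auto simp: null_sets_def assms)
  then have "\<Union>?F \<in> null_sets D" using F by simp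
  then show ?thesis
    by (rule AE_I') (auto simp: measure_support_def zero_less_iff_neq_zero)
qed

section \<open>Tube model predictive control\<close>

text \<open>Stating the constraints along the whole orbit makes the set visibly closed and invariant.\<close>

lemma max_admissible_eq:
  "max_admissible AK K X U = {x. \<forall>t. ((*v) AK ^^ t) x \<in> X \<and> K *v ((*v) AK ^^ t) x \<in> U}"
    (is "_ = ?S")
proof
  show "max_admissible AK K X U \<subseteq> ?S" unfolding max_admissible_def by blast
  have "((*v) AK ^^ t) x \<in> ?S" if "x \<in> ?S" for x t
    using that by (auto simp: funpow_add[symmetric, unfolded comp_def fun_eq_iff, rule_format])
  moreover have "?S \<subseteq> X" by (auto dest: spec[of _ 0])
  ultimately show "?S \<subseteq> max_admissible AK K X U" unfolding max_admissible_def by blast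
qed

lemma max_admissible_step:
  assumes "x \<in> max_admissible AK K X U"
  shows "x \<in> X" "K *v x \<in> U" "AK *v x \<in> max_admissible AK K X U"
proof -
  have *: "((*v) AK ^^ t) x \<in> X \<and> K *v ((*v) AK ^^ t) x \<in> U" for t
    using assms unfolding max_admissible_eq by blast
  show "x \<in> X" "K *v x \<in> U" using *[of 0] by auto
  have "((*v) AK ^^ t) (AK *v x) = ((*v) AK ^^ Suc t) x" for t
    by (simp only: funpow_Suc_right comp_def)
  then show "AK *v x \<in> max_admissible AK K X U"
    using *[of "Suc _"] unfolding max_admissible_eq by (simp del: funpow.simps)
qed

lemma closed_minkowski_diff:
  fixes S :: "'v::real_normed_vector set"
  assumes "closed S" shows "closed (S \<ominus> Y)"
proof -
  have "S \<ominus> Y = S \<inter> (\<Inter>y\<in>Y. (\<lambda>x. x + y) -` S)" by (auto simp: minkowski_diff_def)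
  then show ?thesis
    using assms by (auto intro!: closed_Int closed_INT closed_vimage continuous_intros)
qed

text \<open>Closedness is what makes reaching the terminal set a measurable event.\<close>

lemma closed_max_admissible:
  assumes "closed X" "closed U" shows "closed (max_admissible AK K X U)"
proof -
  have f: "continuous_on UNIV (\<lambda>x. ((*v) AK ^^ t) x)" for t
  proof (induction t)
    case (Suc t)
    then show ?case
      using continuous_on_compose2[OF matrix_vector_mult_linear_continuous_on Suc, of UNIV] by simp
  qed simp
  have g: "continuous_on UNIV (\<lambda>x. K *v ((*v) AK ^^ t) x)" for t
    using continuous_on_compose2[OF matrix_vector_mult_linear_continuous_on f] by auto
  have "max_admissible AK K X U =
      (\<Inter>t. (\<lambda>x. ((*v) AK ^^ t) x) -` X \<inter> (\<lambda>x. K *v ((*v) AK ^^ t) x) -` U)"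
    unfolding max_admissible_eq by auto
  then show ?thesis
    using assms f g by (auto intro!: closed_INT closed_Int closed_vimage)
qed

text \<open>Recursive feasibility: the tail of a feasible plan, continued by the linear feedback from
  its terminal state, is a feasible plan for the successor state.\<close>

lemma mpc_feasible_shift:
  assumes N: "1 \<le> N" and feas: "mpc_feasible A B X U (max_admissible (A + B ** K) K X U) N z u"
  shows "A *v z + B *v u 0 \<in> mpc_domain A B X U (max_admissible (A + B ** K) K X U) N"
proof -
  let ?O = "max_admissible (A + B ** K) K X U" and ?z' = "A *v z + B *v u 0"
  let ?x = "input_traj A B u z"
  \<comment> \<open>drop the first input of the plan and append the terminal feedback\<close>
  define u' where "u' k = (if Suc k < N then u (Suc k) else K *v ?x N)" for k
  have shift: "input_traj A B u' ?z' k = ?x (Suc k)" if "k < N" for k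
    using that by (induction k) (auto simp: u'_def)
  obtain j where j: "N = Suc j" using N by (cases N) auto
  have last: "input_traj A B u' ?z' N = (A + B ** K) *v ?x N"
    using shift[of j] by (simp add: j u'_def matrix_vector_mult_add_rdistrib matrix_vector_mul_assoc)
  have xN: "?x N \<in> ?O" using feas by (simp add: mpc_feasible_def)
  note O = max_admissible_step[OF xN]
  have "mpc_feasible A B X U ?O N ?z' u'"
    unfolding mpc_feasible_def
  proof (intro conjI allI impI)
    fix k assume "k \<le> N"
    then show "input_traj A B u' ?z' k \<in> X"
      using shift[of k] feas last max_admissible_step(1)[OF O(3)]
      by (cases "k = N") (auto simp: mpc_feasible_def simp del: input_traj.simps)
  next
    fix k assume "k < N"
    then show "u' k \<in> U" using feas O(2) by (auto simp: u'_def mpc_feasible_def)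
  next
    show "input_traj A B u' ?z' N \<in> ?O" using last O(3) by simp
  qed
  then show ?thesis by (auto simp: mpc_domain_def)
qed

locale tube_mpc =
  fixes A Q P AK :: "real^'n^'n" and B :: "real^'m^'n" and R :: "real^'m^'m" and K :: "real^'n^'m"
    and X \<Delta> Xbar Oinf X0bar Dom :: "(real^'n) set" and U Ubar :: "(real^'m) set"
    and \<epsilon> :: real and N :: nat
    and xbar :: "real^'n \<Rightarrow> real^'n" and ubar :: "real^'n \<Rightarrow> nat \<Rightarrow> real^'m"
    and expert :: "real^'n \<Rightarrow> real^'m"
  assumes AK: "AK = A + B ** K"
    and \<Delta>: "disturbance_invariant AK (cball 0 \<epsilon>) \<Delta>"
    and Xbar: "Xbar = X \<ominus> \<Delta>"
    and Ubar: "Ubar = U \<ominus> ((*v) K ` \<Delta>)"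
    and Oinf: "Oinf = max_admissible AK K Xbar Ubar"
    and N: "1 \<le> N"
    and X0bar: "X0bar = mpc_domain A B Xbar Ubar Oinf N"
    and Dom: "Dom = (X0bar + \<Delta>) \<inter> X"
    and opt: "\<forall>x\<in>Dom. robust_mpc_optimal A B Q R P Xbar Ubar Oinf N \<Delta> x (xbar x) (ubar x)"
    and expert: "expert = robust_mpc_controller K Dom xbar ubar"
begin

lemma X0bar_subset_Xbar: "X0bar \<subseteq> Xbar"
  unfolding X0bar mpc_domain_def mpc_feasible_def by (auto dest!: spec[of _ 0])

lemma X0bar_subset_Dom: "X0bar \<subseteq> Dom"
proof
  fix x assume x: "x \<in> X0bar"
  have "0 \<in> \<Delta>" using \<Delta> interior_subset by (auto simp: disturbance_invariant_def)
  with x have "x + 0 \<in> X0bar + \<Delta>" by (rule set_plus_intro)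
  then show "x \<in> Dom"
    using x X0bar_subset_Xbar by (auto simp: Dom Xbar minkowski_diff_def)
qed

lemma optimal_tube:
  assumes "x \<in> Dom"
  shows "mpc_feasible A B Xbar Ubar Oinf N (xbar x) (ubar x)" "x - xbar x \<in> \<Delta>"
proof -
  have *: "mpc_feasible A B Xbar Ubar Oinf N (xbar x) (ubar x)" "x \<in> {xbar x} + \<Delta>"
    using opt assms by (auto simp: robust_mpc_optimal_def is_arg_min_def)
  show "mpc_feasible A B Xbar Ubar Oinf N (xbar x) (ubar x)" by (rule *)
  show "x - xbar x \<in> \<Delta>" using *(2) by (auto elim!: set_plus_elim)
qed

text \<open>The tube argument. Write \<open>x = z + d\<close> with the nominal state \<open>z\<close> and \<open>d \<in> \<Delta>\<close>. The ancillary
  feedback \<open>K\<close> makes the deviation evolve by \<open>d \<mapsto> AK d + w\<close>, which stays in \<open>\<Delta>\<close>, while the nominal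
  part moves along its feasible plan and so remains feasible. Tightening by \<open>\<Delta>\<close> then yields the
  true state constraint.\<close>

lemma Dom_invariant:
  assumes x: "x \<in> Dom" and w: "norm w \<le> \<epsilon>"
  shows "A *v x + B *v expert x + w \<in> Dom"
proof -
  define d where "d = x - xbar x"
  let ?z = "A *v xbar x + B *v ubar x 0" and ?d = "AK *v d + w"
  have z: "?z \<in> X0bar"
    using mpc_feasible_shift[OF N] optimal_tube(1)[OF x] by (simp add: X0bar Oinf AK)
  have "AK *v d \<in> (*v) AK ` \<Delta>" using optimal_tube(2)[OF x] by (simp add: d_def)
  moreover have "w \<in> cball 0 \<epsilon>" using w by simp
  ultimately have d: "?d \<in> \<Delta>"
    using \<Delta> by (auto simp: disturbance_invariant_def intro!: set_plus_intro)
  have e: "expert x = ubar x 0 + K *v d"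
    using x by (simp add: expert robust_mpc_controller_def d_def)
  have "x = xbar x + d" by (simp add: d_def)
  then have "A *v x = A *v xbar x + A *v d" by (metis matrix_vector_right_distrib)
  then have eq: "A *v x + B *v expert x + w = ?z + ?d"
    by (simp add: e AK matrix_vector_right_distrib matrix_vector_mult_add_rdistrib
        matrix_vector_mul_assoc algebra_simps)
  have "?z + ?d \<in> X0bar + \<Delta>" using z d by (rule set_plus_intro)
  moreover have "?z + ?d \<in> X"
    using z d X0bar_subset_Xbar by (auto simp: Xbar minkowski_diff_def)
  ultimately show ?thesis by (simp add: eq Dom)
qed

lemma disturbed_traj_in_Dom:
  assumes "x0 \<in> X0bar" "\<And>t. norm (w t) \<le> \<epsilon>"
  shows "disturbed_traj A B expert w x0 t \<in> Dom"
  using assms X0bar_subset_Dom by (induction t) (auto intro!: Dom_invariant)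

text \<open>The terminal condition on the nominal state carries a margin \<open>\<Delta>\<close>, exactly what the deviation
  of the true state can consume.\<close>

lemma nominal_terminal_imp_terminal:
  assumes "x \<in> Dom" "xbar x \<in> Oinf \<ominus> \<Delta>"
  shows "x \<in> Oinf"
  using assms optimal_tube(2)[of x] by (fastforce simp: minkowski_diff_def)

text \<open>An imitation error of size \<open>\<epsilon> / \<parallel>B\<parallel>\<close> in the input displaces the next state by at most \<open>\<epsilon>\<close>,
  so a learned trajectory is an expert trajectory under an admissible disturbance. The disturbance
  is set to \<open>0\<close> from time \<open>t\<close> on, where nothing is known about the errors, and for \<open>B = 0\<close> it
  vanishes.\<close>

lemma traj_eq_disturbed_traj:
  fixes p :: "nat \<Rightarrow> real^'n \<Rightarrow> real^'m"
  assumes \<epsilon>: "0 \<le> \<epsilon>"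
    and err: "\<And>s. s < t \<Longrightarrow> B \<noteq> 0 \<Longrightarrow>
      norm (expert (traj A B p x0 s) - p s (traj A B p x0 s)) \<le> \<epsilon> / op_norm B"
  obtains w where "\<And>s. norm (w s) \<le> \<epsilon>"
    "\<And>s. s \<le> t \<Longrightarrow> traj A B p x0 s = disturbed_traj A B expert w x0 s"
proof
  let ?x = "traj A B p x0"
  define w where "w s = (if s < t then B *v (p s (?x s) - expert (?x s)) else 0)" for s
  show "norm (w s) \<le> \<epsilon>" for s
  proof (cases "s < t \<and> B \<noteq> 0")
    case True
    then have pos: "op_norm B > 0" by (simp add: op_norm_pos)
    have "norm (w s) \<le> op_norm B * norm (p s (?x s) - expert (?x s))"
      using True norm_matrix_vector_le by (auto simp: w_def)
    also have "\<dots> \<le> op_norm B * (\<epsilon> / op_norm B)"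
      using err[of s] True pos by (intro mult_left_mono) (auto simp: norm_minus_commute)
    finally show ?thesis using pos by simp
  qed (use \<epsilon> in \<open>auto simp: w_def\<close>)
  show "?x s = disturbed_traj A B expert w x0 s" if "s \<le> t" for s
    using that
  proof (induction s)
    case (Suc s)
    then have eq: "disturbed_traj A B expert w x0 s = ?x s" by simp
    from Suc.prems show ?case
      by (simp add: eq) (simp add: w_def matrix_vector_mult_diff_distrib)
  qed simp
qed

text \<open>Before the switch, states remain in the invariant domain of the expert, and inputs are
  admissible because the learned policies only produce admissible ones. After the switch the
  system is the linear feedback loop inside its admissible set.\<close>

lemma switched_controller_safe:
  fixes p :: "nat \<Rightarrow> real^'n \<Rightarrow> real^'m"
  assumes \<epsilon>: "0 \<le> \<epsilon>" and x0: "x0 \<in> X0bar" and pU: "\<And>t x. t < \<tau> \<Longrightarrow> p t x \<in> U"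
    and err: "\<And>s. s < \<tau> \<Longrightarrow> B \<noteq> 0 \<Longrightarrow>
      norm (expert (traj A B p x0 s) - p s (traj A B p x0 s)) \<le> \<epsilon> / op_norm B"
    and terminal: "traj A B p x0 \<tau> \<in> Oinf"
  defines "q \<equiv> switched_controller K \<tau> p"
  shows "traj A B q x0 t \<in> X" and "q t (traj A B q x0 t) \<in> U"
proof -
  have before: "traj A B q x0 t = traj A B p x0 t" if "t \<le> \<tau>" for t
    using that by (intro traj_cong) (auto simp: q_def switched_controller_def)
  have after: "traj A B q x0 (\<tau> + k) \<in> Oinf" for k
  proof (induction k)
    case 0
    then show ?case using terminal before by simp
  next
    case (Suc k)
    have "traj A B q x0 (\<tau> + Suc k) = AK *v traj A B q x0 (\<tau> + k)"
      by (simp add: q_def switched_controller_def AK matrix_vector_mult_add_rdistrib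
          matrix_vector_mul_assoc)
    then show ?case using max_admissible_step(3) Suc by (simp add: Oinf)
  qed
  obtain w where w: "\<And>s. norm (w s) \<le> \<epsilon>"
    "\<And>s. s \<le> \<tau> \<Longrightarrow> traj A B p x0 s = disturbed_traj A B expert w x0 s"
    using traj_eq_disturbed_traj[where p = p and t = \<tau> and ?x0.0 = x0] \<epsilon> err by blast
  show "traj A B q x0 t \<in> X"
  proof (cases "t < \<tau>")
    case True
    then show ?thesis
      using before[of t] w(2)[of t] disturbed_traj_in_Dom[OF x0, of w t] w(1) by (simp add: Dom)
  next
    case False
    then have "traj A B q x0 t \<in> Oinf" using after[of "t - \<tau>"] by simp
    then have "traj A B q x0 t \<in> Xbar" unfolding Oinf by (rule max_admissible_step(1))
    then show ?thesis by (simp add: Xbar minkowski_diff_def)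
  qed
  show "q t (traj A B q x0 t) \<in> U"
  proof (cases "t < \<tau>")
    case True
    then show ?thesis using pU by (simp add: q_def switched_controller_def)
  next
    case False
    then have "traj A B q x0 t \<in> Oinf" using after[of "t - \<tau>"] by simp
    then have "K *v traj A B q x0 t \<in> Ubar" unfolding Oinf by (rule max_admissible_step(2))
    then have "K *v traj A B q x0 t \<in> U" by (simp add: Ubar minkowski_diff_def)
    with False show ?thesis by (simp add: q_def switched_controller_def)
  qed
qed

end

section \<open>Guarantees for Forward-Switch\<close>

theorem theorem4p3:
  fixes A Q P AK :: "real^'n^'n" and B :: "real^'m^'n" and R :: "real^'m^'m" and K :: "real^'n^'m"
    and X W \<Delta> Xbar Oinf X0bar Dom :: "(real^'n) set" and U Ubar :: "(real^'m) set"
    and \<rho> \<tau> \<kappa> \<epsilon> \<delta> Bu :: real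
    and N T l n \<tau>star :: nat
    and xbar :: "real^'n \<Rightarrow> real^'n" and ubar :: "real^'n \<Rightarrow> nat \<Rightarrow> real^'m"
    and expert :: "real^'n \<Rightarrow> real^'m" and Pol :: "(real^'n \<Rightarrow> real^'m) set"
    and D :: "(real^'n) measure"
    and phat :: "(sample \<Rightarrow> real^'n) \<Rightarrow> nat \<Rightarrow> real^'n \<Rightarrow> real^'m"
    and \<tau>hat :: "(sample \<Rightarrow> real^'n) \<Rightarrow> nat"
  assumes X: "closed X" "convex X" "0 \<in> X"
    and U: "closed U" "convex U" "0 \<in> U" "bounded U"
    and QR: "pos_semidef Q" "pos_def R"
    and P: "pos_def P" "riccati_solution A B Q R P"
           "\<forall>P'. pos_def P' \<and> riccati_solution A B Q R P' \<longrightarrow> P' = P"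
    and K: "K = lqr_gain A B R P"
    and AK: "AK = A + B ** K" "spectral_radius AK < 1"
    and \<rho>: "spectral_radius AK < \<rho>" "\<rho> < 1"
    and \<tau>: "0 < \<tau>" "\<forall>k. onorm ((*v) AK ^^ k) \<le> \<tau> * \<rho> ^ k"
    and \<kappa>: "\<kappa> = \<tau> / (1 - \<rho>)"
    and \<delta>: "0 < \<delta>" "\<delta> < 1"
    and \<epsilon>: "0 < \<epsilon>" "\<epsilon> < 1"
    and W: "W = cball 0 \<epsilon>"
    and \<Delta>: "disturbance_invariant AK W \<Delta>" "\<Delta> \<subseteq> cball 0 (\<kappa> * \<epsilon>)"
    and Xbar: "Xbar = X \<ominus> \<Delta>"
    and Ubar: "Ubar = U \<ominus> ((*v) K ` \<Delta>)"
    and Oinf: "Oinf = max_admissible AK K Xbar Ubar"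
    and N: "1 \<le> N"
    and X0bar: "X0bar = mpc_domain A B Xbar Ubar Oinf N"
    and Dom: "Dom = (X0bar + \<Delta>) \<inter> X"
    and opt: "\<forall>x\<in>Dom. robust_mpc_optimal A B Q R P Xbar Ubar Oinf N \<Delta> x (xbar x) (ubar x)"
    and expert: "expert = robust_mpc_controller K Dom xbar ubar"
    and D: "prob_space D" "sets D = sets borel" "AE x in D. x \<in> X0bar"
    and D_bounded: "\<exists>r. AE x in D. norm x \<le> r"
    and \<tau>star: "1 \<le> \<tau>star"
               "\<forall>x0 \<in> measure_support D. \<forall>w. (\<forall>t. w t \<in> W) \<longrightarrow>
                  xbar (disturbed_traj A B expert w x0 \<tau>star) \<in> Oinf \<ominus> \<Delta>"
    and Pol: "finite Pol" "expert \<in> Pol" "\<forall>p\<in>Pol. \<forall>x. p x \<in> U"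
             "\<forall>p\<in>Pol. p \<in> borel_measurable borel"
    and T: "1 \<le> T"
    and Bu: "Bu = (SUP u\<in>U. norm u)"
    and l: "real l \<ge> 10 * ln (real T / \<delta>) / \<delta>"
    and n: "real n \<ge> 14 * real l * op_norm B * Bu
                        * ln (2 * real T * real l * real (card Pol) / \<delta>) / (\<epsilon> * \<delta>)"
    and learner: "data_driven D Pol T phat"
    and run: "\<forall>\<omega> \<in> space (training_space D).
                forward_switch_run A B Oinf expert Pol n T l \<omega> (phat \<omega>) (\<tau>hat \<omega>)"
  shows "\<exists>E \<in> sets (training_space D). measure (training_space D) E \<ge> 1 - 3 * \<delta> \<and>
    (\<forall>\<omega>\<in>E.
       (let xhat = traj A B (phat \<omega>);
            ptilde = switched_controller K (\<tau>hat \<omega>) (phat \<omega>);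
            xtilde = traj A B ptilde;
            ev_i = (\<lambda>x0. xhat x0 (\<tau>hat \<omega>) \<in> Oinf);
            ev_ii = (\<lambda>x0. \<forall>t<\<tau>hat \<omega>.
                       B \<noteq> 0 \<longrightarrow> norm (expert (xhat x0 t) - phat \<omega> t (xhat x0 t)) \<le> \<epsilon> / op_norm B)
        in \<tau>hat \<omega> \<le> \<tau>star
           \<and> (\<tau>star \<le> T \<or> \<tau>hat \<omega> < T \<longrightarrow> \<P>(x0 in D. ev_i x0) \<ge> 1 - \<delta>)
           \<and> \<P>(x0 in D. ev_ii x0) \<ge> 1 - \<delta>
           \<and> (\<forall>x0\<in>X0bar. ev_i x0 \<and> ev_ii x0 \<longrightarrow>
                (\<forall>t\<le>T. xtilde x0 t \<in> X) \<and> (\<forall>t<T. ptilde t (xtilde x0 t) \<in> U))))"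
proof -
  interpret D: prob_space D by (rule D)
  let ?M = "training_space D"
  interpret M: prob_space ?M by (rule prob_space_training_space[OF D(1)])
  interpret tube_mpc A Q P AK B R K X \<Delta> Xbar Oinf X0bar Dom U Ubar \<epsilon> N xbar ubar expert
    by unfold_locales (fact AK(1) \<Delta>(1)[unfolded W] Xbar Ubar Oinf N X0bar Dom opt expert)+
  have spaceD: "space D = UNIV" using sets_eq_imp_space_eq[OF D(2)] by simp
  have n_stages: "real T * (1 - \<delta>) ^ l \<le> \<delta>" and l0: "0 < l"
    using num_tests_sufficient[OF \<delta> T l] by simp_all

  \<comment> \<open>For \<open>B = 0\<close> no error matters, whereas the tolerance \<open>\<epsilon> / op_norm B\<close> would be \<open>0\<close>.\<close>
  define Err where "Err t p q = {x0. B \<noteq> 0 \<and>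
      \<epsilon> / op_norm B < norm (expert (traj A B p x0 t) - q (traj A B p x0 t))}" for t p q
  define Hit where "Hit t p = {x0. traj A B p x0 t \<in> Oinf}" for t p

  have Err_meas: "Err t p q \<in> sets D" if "\<And>s. s < t \<Longrightarrow> p s \<in> Pol" "q \<in> Pol" for t p q
  proof -
    have x: "(\<lambda>x. traj A B p x t) \<in> borel_measurable borel"
      using that Pol(4) by (intro traj_measurable) auto
    have "(\<lambda>x. expert (traj A B p x t)) \<in> borel_measurable borel"
      "(\<lambda>x. q (traj A B p x t)) \<in> borel_measurable borel"
      using that Pol(2,4) by (auto intro: measurable_compose[OF x])
    then show ?thesis unfolding Err_def D(2) by measurable
  qed
  have "closed Xbar" "closed Ubar" using X(1) U(1) by (auto simp: Xbar Ubar closed_minkowski_diff)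
  then have Oinf_closed: "closed Oinf" by (simp add: Oinf closed_max_admissible)
  have Hit_meas: "Hit t p \<in> sets D" if "\<And>s. s < t \<Longrightarrow> p s \<in> Pol" for t p
  proof -
    have "(\<lambda>x. traj A B p x t) \<in> borel_measurable borel"
      using that Pol(4) by (intro traj_measurable) auto
    from measurable_sets[OF this, of Oinf] Oinf_closed show ?thesis
      by (simp add: Hit_def D(2) vimage_def)
  qed
  have Err_cong: "Err t p q = Err t p' q" if "\<And>s. s < t \<Longrightarrow> p s = p' s" for t p p' q
    unfolding Err_def using traj_cong[of t p p'] that by simp
  have Hit_cong: "Hit t p = Hit t p'" if "\<And>s. s < t \<Longrightarrow> p s = p' s" for t p p'
    unfolding Hit_def using traj_cong[of t p p'] that by simp

  have phat_Pol: "phat \<omega> t \<in> Pol" if "\<omega> \<in> space ?M" "t < T" for \<omega> t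
    using data_driven_mem[OF learner] that by blast
  note run' = run[rule_format]
  note stop = forward_switch_run_stop[OF run' T]

  have "\<exists>E \<in> sets ?M. measure ?M E \<ge> 1 - \<delta> \<and>
      (\<forall>\<omega>\<in>E. measure D (\<Union>t<\<tau>hat \<omega>. Err t (phat \<omega>) (phat \<omega> t)) \<le> \<delta> / real l)"
  proof (cases "B = 0 \<or> 2 * (op_norm B * Bu) \<le> \<epsilon>")
    case True
    \<comment> \<open>all policies have values of norm at most \<open>Bu\<close>, so no two of them differ by more than the
      tolerance\<close>
    have "Err t p q = {}" if q: "q \<in> Pol" for t p q
    proof -
      have "norm (expert y - q y) \<le> \<epsilon> / op_norm B" if "B \<noteq> 0" for y
      proof -
        have bound: "norm u \<le> Bu" if "u \<in> U" for u
          unfolding Bu using that U(4) by (intro cSUP_upper) (auto simp: bounded_iff bdd_above_def)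
        have "norm (expert y - q y) \<le> norm (expert y) + norm (q y)" by (rule norm_triangle_ineq4)
        also have "\<dots> \<le> 2 * Bu" using bound[of "expert y"] bound[of "q y"] Pol(2,3) q by auto
        also have "\<dots> \<le> \<epsilon> / op_norm B"
          using True that op_norm_pos[of B] by (simp add: field_simps)
        finally show ?thesis .
      qed
      then show ?thesis by (auto simp: Err_def not_less)
    qed
    then have "(\<Union>t<\<tau>hat \<omega>. Err t (phat \<omega>) (phat \<omega> t)) = {}" if "\<omega> \<in> space ?M" for \<omega>
      using phat_Pol[OF that] stop(2)[OF that] by auto
    then show ?thesis
      using \<delta> by (intro bexI[of _ "space ?M"]) (auto simp: M.prob_space)
  next
    case False
    have card: "1 \<le> card Pol" using Pol(1,2) by (auto simp: Suc_le_eq card_gt_0_iff)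
    have budget: "0 < n" "(\<Sum>t<T. ln (real (card Pol) * real T / \<delta>) / real (num_samples n t)) \<le> \<delta> / real l"
      using stagewise_error_budget[OF \<delta> T l0 card, of \<epsilon> "op_norm B * Bu" n] False \<epsilon>(1) n
      by (simp_all add: mult.assoc)
    have m0: "0 < num_samples n t" for t using num_samples_ge[of n t] budget(1) by linarith
    have "Pol \<noteq> {}" using Pol(2) by auto
    from zero_empirical_error_generalizes[where Err = Err and m = "num_samples n",
        OF D(1) learner Pol(1) this T \<delta>(1) m0 Err_meas Err_cong]
    obtain E where E: "E \<in> sets ?M" "measure ?M E \<ge> 1 - \<delta>"
      "\<And>\<omega> t. \<omega> \<in> E \<Longrightarrow> t < T \<Longrightarrow>
         (\<forall>i<num_samples n t. \<omega> (Train t i) \<notin> Err t (phat \<omega>) (phat \<omega> t)) \<Longrightarrow>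
         measure D (Err t (phat \<omega>) (phat \<omega> t)) \<le> ln (real (card Pol) * real T / \<delta>) / real (num_samples n t)"
      by blast
    have "measure D (\<Union>t<\<tau>hat \<omega>. Err t (phat \<omega>) (phat \<omega> t)) \<le> \<delta> / real l" if \<omega>: "\<omega> \<in> E" for \<omega>
    proof -
      have sp: "\<omega> \<in> space ?M" using \<omega> E(1) sets.sets_into_space by blast
      note \<tau>T = stop(2)[OF sp]
      have stage: "measure D (Err t (phat \<omega>) (phat \<omega> t))
          \<le> ln (real (card Pol) * real T / \<delta>) / real (num_samples n t)" if t: "t < \<tau>hat \<omega>" for t
      proof (rule E(3)[OF \<omega>])
        show "t < T" using t \<tau>T by simp
        have "is_arg_min (empirical_loss (num_samples n t) expert
            (\<lambda>i. traj A B (phat \<omega>) (\<omega> (Train t i)) t)) (\<lambda>q. q \<in> Pol) (phat \<omega> t)"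
          using run'[OF sp] t by (simp add: forward_switch_run_def)
        from realizable_empirical_minimizer[OF this Pol(2)]
        show "\<forall>i<num_samples n t. \<omega> (Train t i) \<notin> Err t (phat \<omega>) (phat \<omega> t)"
          using \<epsilon>(1) onorm_pos_le[OF matrix_vector_mul_bounded_linear, of B]
          by (auto simp: Err_def not_less)
      qed
      have "measure D (\<Union>t<\<tau>hat \<omega>. Err t (phat \<omega>) (phat \<omega> t))
          \<le> (\<Sum>t<\<tau>hat \<omega>. measure D (Err t (phat \<omega>) (phat \<omega> t)))"
        using phat_Pol[OF sp] \<tau>T
        by (intro D.finite_measure_subadditive_finite) (auto intro!: Err_meas)
      also have "\<dots> \<le> (\<Sum>t<\<tau>hat \<omega>. ln (real (card Pol) * real T / \<delta>) / real (num_samples n t))"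
        using stage by (intro sum_mono) auto
      also have "\<dots> \<le> (\<Sum>t<T. ln (real (card Pol) * real T / \<delta>) / real (num_samples n t))"
      proof (intro sum_mono2)
        have "1 * 1 \<le> card Pol * T" using card T by (intro mult_le_mono)
        then have "1 \<le> real (card Pol) * real T" by (metis of_nat_mult of_nat_1 of_nat_le_iff mult_1)
        then have "0 \<le> ln (real (card Pol) * real T / \<delta>)"
          using \<delta> by (intro ln_ge_zero) (simp add: field_simps)
        then show "0 \<le> ln (real (card Pol) * real T / \<delta>) / real (num_samples n t)" for t by simp
      qed (use \<tau>T in auto)
      also have "\<dots> \<le> \<delta> / real l" by (rule budget(2))
      finally show ?thesis .
    qed
    then show ?thesis using E(1,2) by blast
  qed
  then obtain E1 where E1: "E1 \<in> sets ?M" "measure ?M E1 \<ge> 1 - \<delta>"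
    "\<And>\<omega>. \<omega> \<in> E1 \<Longrightarrow> measure D (\<Union>t<\<tau>hat \<omega>. Err t (phat \<omega>) (phat \<omega> t)) \<le> \<delta> / real l"
    by blast
  obtain E2 where E2: "E2 \<in> sets ?M" "measure ?M E2 \<ge> 1 - \<delta>"
    "\<And>\<omega> t. \<omega> \<in> E2 \<Longrightarrow> t \<in> {1..T} \<Longrightarrow> (\<forall>i<l. \<omega> (Test t i) \<in> Hit t (phat \<omega>)) \<Longrightarrow>
       measure D (Hit t (phat \<omega>)) \<ge> 1 - \<delta>"
    using passed_tests_are_reliable[where V = Hit, OF D(1) learner Pol(1) \<delta> n_stages Hit_meas Hit_cong]
    by blast
  have "\<exists>E \<in> sets ?M. measure ?M E \<ge> 1 - \<delta> \<and> (\<forall>\<omega>\<in>E. \<tau>star \<le> T \<longrightarrow>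
      measure D (- Hit \<tau>star (phat \<omega>)) \<le> \<delta> / real l \<longrightarrow>
      (\<forall>i<l. \<omega> (Test \<tau>star i) \<in> Hit \<tau>star (phat \<omega>)))"
  proof (cases "\<tau>star \<le> T")
    case True
    have meas: "- Hit \<tau>star p \<in> sets D" if "\<And>s. s < \<tau>star \<Longrightarrow> p s \<in> Pol" for p
      using sets.compl_sets[OF Hit_meas[OF that]] by (simp add: spaceD Compl_eq_Diff_UNIV)
    have cong: "- Hit \<tau>star p = - Hit \<tau>star p'" if "\<And>s. s < \<tau>star \<Longrightarrow> p s = p' s" for p p'
      using Hit_cong[OF that] by simp
    obtain E where "E \<in> sets ?M" "measure ?M E \<ge> 1 - \<delta>"
      "\<forall>\<omega>\<in>E. measure D (- Hit \<tau>star (phat \<omega>)) \<le> \<delta> / real l \<longrightarrow>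
         (\<forall>i<l. \<omega> (Test \<tau>star i) \<notin> - Hit \<tau>star (phat \<omega>))"
      using rare_event_avoids_tests[where V = "\<lambda>p. - Hit \<tau>star p",
          OF D(1) learner Pol(1) True less_imp_le[OF \<delta>(1)] l0 meas cong] by blast
    then show ?thesis by (intro bexI[of _ E]) auto
  next
    case False
    then show ?thesis using \<delta> by (intro bexI[of _ "space ?M"]) (auto simp: M.prob_space)
  qed
  then obtain E3 where E3: "E3 \<in> sets ?M" "measure ?M E3 \<ge> 1 - \<delta>"
    "\<And>\<omega>. \<omega> \<in> E3 \<Longrightarrow> \<tau>star \<le> T \<Longrightarrow> measure D (- Hit \<tau>star (phat \<omega>)) \<le> \<delta> / real l \<Longrightarrow>
      \<forall>i<l. \<omega> (Test \<tau>star i) \<in> Hit \<tau>star (phat \<omega>)"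
    by blast
  \<comment> \<open>\<open>E1\<close>: small errors up to the stopping time; \<open>E2\<close>: passed tests are trustworthy; \<open>E3\<close>: no
    spurious failure at \<open>\<tau>star\<close>\<close>
  define E where "E = E1 \<inter> E2 \<inter> E3"
  have E: "E \<in> sets ?M" "E \<subseteq> space ?M" using E1(1) E2(1) E3(1) sets.sets_into_space by (auto simp: E_def)
  have E_prob: "measure ?M E \<ge> 1 - 3 * \<delta>"
  proof -
    have "measure ?M (space ?M - E) \<le> measure ?M ((space ?M - E1) \<union> (space ?M - E2) \<union> (space ?M - E3))"
      using E1(1) E2(1) E3(1) by (intro M.finite_measure_mono) (auto simp: E_def)
    also have "\<dots> \<le> measure ?M (space ?M - E1) + measure ?M (space ?M - E2) + measure ?M (space ?M - E3)"
      using E1(1) E2(1) E3(1)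
      by (intro order_trans[OF measure_Un_le] add_right_mono measure_Un_le) auto
    also have "\<dots> \<le> 3 * \<delta>"
      using E1(1,2) E2(1,2) E3(1,2) by (simp add: M.prob_compl)
    finally show ?thesis using E(1) by (simp add: M.prob_compl)
  qed

  have arrival: "measure D (- Hit \<tau>star (phat \<omega>)) \<le> \<delta> / real l"
    if \<omega>: "\<omega> \<in> E" and le: "\<tau>star \<le> \<tau>hat \<omega>" for \<omega>
  proof -
    have sp: "\<omega> \<in> space ?M" using \<omega> E by blast
    note \<tau>T = stop(2)[OF sp]
    have good: "x0 \<in> Hit \<tau>star (phat \<omega>)"
      if x0: "x0 \<in> X0bar" "x0 \<in> measure_support D"
        and ne: "x0 \<notin> (\<Union>t<\<tau>hat \<omega>. Err t (phat \<omega>) (phat \<omega> t))" for x0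
    proof -
      have "norm (expert (traj A B (phat \<omega>) x0 s) - phat \<omega> s (traj A B (phat \<omega>) x0 s)) \<le> \<epsilon> / op_norm B"
        if "s < \<tau>star" "B \<noteq> 0" for s
        using ne that le by (auto simp: Err_def not_less)
      then obtain w where w: "\<And>s. norm (w s) \<le> \<epsilon>"
        "\<And>s. s \<le> \<tau>star \<Longrightarrow> traj A B (phat \<omega>) x0 s = disturbed_traj A B expert w x0 s"
        using traj_eq_disturbed_traj[where p = "phat \<omega>" and t = \<tau>star and ?x0.0 = x0] \<epsilon>(1) by auto
      have "xbar (disturbed_traj A B expert w x0 \<tau>star) \<in> Oinf \<ominus> \<Delta>"
        using \<tau>star(2) x0(2) w(1) by (simp add: W)
      then show ?thesis
        using nominal_terminal_imp_terminal disturbed_traj_in_Dom[OF x0(1), of w \<tau>star] w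
        by (simp add: Hit_def)
    qed
    have Hc: "- Hit \<tau>star (phat \<omega>) \<in> sets D"
      using sets.compl_sets[OF Hit_meas[of \<tau>star "phat \<omega>"]] phat_Pol[OF sp] le \<tau>T
      by (simp add: spaceD Compl_eq_Diff_UNIV)
    have Um: "(\<Union>t<\<tau>hat \<omega>. Err t (phat \<omega>) (phat \<omega> t)) \<in> sets D"
      using phat_Pol[OF sp] \<tau>T by (intro sets.finite_UN) (auto intro!: Err_meas)
    have "AE x0 in D. x0 \<in> - Hit \<tau>star (phat \<omega>) \<longrightarrow> x0 \<in> (\<Union>t<\<tau>hat \<omega>. Err t (phat \<omega>) (phat \<omega> t))"
      using D(3) AE_measure_support[OF D(2)] by eventually_elim (use good in auto)
    then have "measure D (- Hit \<tau>star (phat \<omega>)) \<le> measure D (\<Union>t<\<tau>hat \<omega>. Err t (phat \<omega>) (phat \<omega> t))"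
      using Um by (rule D.finite_measure_mono_AE)
    also have "\<dots> \<le> \<delta> / real l" using E1(3) \<omega> by (simp add: E_def)
    finally show ?thesis .
  qed

  have claim: "\<tau>hat \<omega> \<le> \<tau>star"
    "\<tau>star \<le> T \<or> \<tau>hat \<omega> < T \<Longrightarrow> measure D (Hit (\<tau>hat \<omega>) (phat \<omega>)) \<ge> 1 - \<delta>"
    "measure D {x0. \<forall>t<\<tau>hat \<omega>. x0 \<notin> Err t (phat \<omega>) (phat \<omega> t)} \<ge> 1 - \<delta>"
    if \<omega>: "\<omega> \<in> E" for \<omega>
  proof -
    have sp: "\<omega> \<in> space ?M" using \<omega> E by blast
    note \<tau> = stop[OF sp]
    have passed: "test_passed A B Oinf l \<omega> (phat \<omega>) t \<longleftrightarrow> (\<forall>i<l. \<omega> (Test t i) \<in> Hit t (phat \<omega>))" for t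
      by (simp add: test_passed_def Hit_def)
    have small: "\<delta> / real l \<le> \<delta>" using l0 \<delta> by (simp add: divide_le_eq)
    show le: "\<tau>hat \<omega> \<le> \<tau>star"
    proof (rule ccontr)
      assume "\<not> \<tau>hat \<omega> \<le> \<tau>star"
      then have "\<tau>star \<le> \<tau>hat \<omega>" "\<tau>star \<le> T" using \<tau>(2) by auto
      then have "test_passed A B Oinf l \<omega> (phat \<omega>) \<tau>star"
        using E3(3)[of \<omega>] arrival[OF \<omega>] \<omega> by (simp add: passed E_def)
      then show False using \<tau>(4) \<tau>star(1) \<open>\<tau>star \<le> T\<close> \<open>\<not> \<tau>hat \<omega> \<le> \<tau>star\<close> by blast
    qed
    show "measure D (Hit (\<tau>hat \<omega>) (phat \<omega>)) \<ge> 1 - \<delta>" if c: "\<tau>star \<le> T \<or> \<tau>hat \<omega> < T"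
    proof (cases "test_passed A B Oinf l \<omega> (phat \<omega>) (\<tau>hat \<omega>)")
      case True
      then show ?thesis using E2(3)[of \<omega> "\<tau>hat \<omega>"] \<omega> \<tau>(1,2) by (simp add: passed E_def)
    next
      case False
      \<comment> \<open>No test was passed, so training ran until \<open>T\<close>; since it ends by \<open>\<tau>star \<le> T\<close>, the two
        times agree.\<close>
      then have eq: "\<tau>hat \<omega> = \<tau>star" using \<tau>(3) c le by auto
      have "Hit \<tau>star (phat \<omega>) \<in> sets D" using phat_Pol[OF sp] eq \<tau>(2) by (intro Hit_meas) auto
      then show ?thesis
        using arrival[OF \<omega>] small D.prob_compl[of "Hit \<tau>star (phat \<omega>)"]
        by (simp add: eq spaceD Compl_eq_Diff_UNIV)
    qed
    have Um: "(\<Union>t<\<tau>hat \<omega>. Err t (phat \<omega>) (phat \<omega> t)) \<in> sets D"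
      using phat_Pol[OF sp] \<tau>(2) by (intro sets.finite_UN) (auto intro!: Err_meas)
    have "{x0. \<forall>t<\<tau>hat \<omega>. x0 \<notin> Err t (phat \<omega>) (phat \<omega> t)}
        = space D - (\<Union>t<\<tau>hat \<omega>. Err t (phat \<omega>) (phat \<omega> t))"
      by (auto simp: spaceD)
    then show "measure D {x0. \<forall>t<\<tau>hat \<omega>. x0 \<notin> Err t (phat \<omega>) (phat \<omega> t)} \<ge> 1 - \<delta>"
      using D.prob_compl[OF Um] E1(3)[of \<omega>] \<omega> small by (simp add: E_def)
  qed

  have safe: "(\<forall>t\<le>T. traj A B (switched_controller K (\<tau>hat \<omega>) (phat \<omega>)) x0 t \<in> X) \<and>
      (\<forall>t<T. switched_controller K (\<tau>hat \<omega>) (phat \<omega>) t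
         (traj A B (switched_controller K (\<tau>hat \<omega>) (phat \<omega>)) x0 t) \<in> U)"
    if \<omega>: "\<omega> \<in> E" and x0: "x0 \<in> X0bar" "x0 \<in> Hit (\<tau>hat \<omega>) (phat \<omega>)"
      and ne: "\<forall>t<\<tau>hat \<omega>. x0 \<notin> Err t (phat \<omega>) (phat \<omega> t)" for \<omega> x0
  proof -
    have sp: "\<omega> \<in> space ?M" using \<omega> E by blast
    have pU: "phat \<omega> t x \<in> U" if "t < \<tau>hat \<omega>" for t x
      using phat_Pol[OF sp, of t] stop(2)[OF sp] that Pol(3) by auto
    have err: "norm (expert (traj A B (phat \<omega>) x0 s) - phat \<omega> s (traj A B (phat \<omega>) x0 s)) \<le> \<epsilon> / op_norm B"
      if "s < \<tau>hat \<omega>" "B \<noteq> 0" for s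
      using ne that by (auto simp: Err_def not_less)
    show ?thesis
      using switched_controller_safe[where p = "phat \<omega>" and \<tau> = "\<tau>hat \<omega>",
          OF less_imp_le[OF \<epsilon>(1)] x0(1) pU err] x0(2) by (auto simp: Hit_def)
  qed

  have Err_iff: "(\<forall>t<\<tau>hat \<omega>. x0 \<notin> Err t (phat \<omega>) (phat \<omega> t)) \<longleftrightarrow>
      (\<forall>t<\<tau>hat \<omega>. B \<noteq> 0 \<longrightarrow>
         norm (expert (traj A B (phat \<omega>) x0 t) - phat \<omega> t (traj A B (phat \<omega>) x0 t)) \<le> \<epsilon> / op_norm B)"
    for \<omega> x0 by (auto simp: Err_def not_less)
  have Hit_iff: "x0 \<in> Hit t p \<longleftrightarrow> traj A B p x0 t \<in> Oinf" for x0 t p by (simp add: Hit_def)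
  show ?thesis
    unfolding Let_def
  proof (intro bexI[OF _ E(1)] conjI E_prob ballI)
    fix \<omega> assume \<omega>: "\<omega> \<in> E"
    show "\<tau>hat \<omega> \<le> \<tau>star" by (rule claim(1)[OF \<omega>])
    show "\<tau>star \<le> T \<or> \<tau>hat \<omega> < T \<longrightarrow>
        \<P>(x0 in D. traj A B (phat \<omega>) x0 (\<tau>hat \<omega>) \<in> Oinf) \<ge> 1 - \<delta>"
      using claim(2)[OF \<omega>] by (simp add: spaceD Hit_def)
    show "\<P>(x0 in D. \<forall>t<\<tau>hat \<omega>. B \<noteq> 0 \<longrightarrow>
        norm (expert (traj A B (phat \<omega>) x0 t) - phat \<omega> t (traj A B (phat \<omega>) x0 t)) \<le> \<epsilon> / op_norm B) \<ge> 1 - \<delta>"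
      using claim(3)[OF \<omega>] by (simp only: Err_iff spaceD UNIV_I simp_thms)
  qed (use safe Err_iff Hit_iff in blast)
qed

end
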